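(* Let $n\in\mathbb N$ ($n\ge1$), $s\in(0,1]$, $\gamma>0$ and $p>1$ with $$1+\frac n4p<p',\qquad\text{i.e.}\qquad p<\frac{n+\sqrt{n^2+16n}}{2n}.$$ Assume that the initial data $(u_0,u_1)\in(H^s\cap\dot H^{-\gamma})\times(L^2\cap\dot H^{-\gamma})$ satisfy $\widehat{u_0+u_1}\ge0$ and, for some $r>0$, some $0\ne a\in\mathbb R^n$ and some constant $c>0$, $$\widehat{u_0+u_1}(\xi+a)\ \ge\ c\,|\xi|^{-\frac n2}\left(\log(|\xi|^{-1})\right)^{-1}\quad\text{for a.e. }\xi\in B(r).$$ Then, for all sufficiently small $\varepsilon>0$, the Cauchy problem $$\partial_t^2u+\partial_tu-\Delta u=|u|^p\quad (x\in\mathbb R^n,\ t>0),\qquad u(0,x)=\varepsilon u_0(x),\quad \partial_tu(0,x)=\varepsilon u_1(x)$$ has no global (in time) weak solution. Moreover, for every sufficiently small $\delta>0$ there is a constant $C>0$ independent of $\varepsilon$ such that, for all sufficiently small $\varepsilon>0$, the lifespan $T$ of the local solution satisfies $$T\le C\,\varepsilon^{-\frac{p}{p'-1-\frac n4p-\delta}}.$$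
   Context: All function spaces are on $\mathbb R^n$. $\hat f$ is the Fourier transform, $H^s$ the usual inhomogeneous Sobolev space, $\|f\|_{\dot H^{-\gamma}}:=\||\xi|^{-\gamma}\hat f\|_{L^2}$ and $\dot H^{-\gamma}:=\{f:\|f\|_{\dot H^{-\gamma}}<\infty\}$. $p'$ is the conjugate exponent, $1/p+1/p'=1$. $B(r):=\{\xi\in\mathbb R^n:|\xi|<r\}$. Weak solution: for $0<T\le\infty$, a weak solution on $[0,T)$ is a function $u\in L^p_{\mathrm{loc}}([0,T)\times\mathbb R^n)$ such that for every $\psi\in C_0^\infty([0,T)\times\mathbb R^n)$ $$\int_0^T\!\!\int_{\mathbb R^n}|u|^p\psi\,dx\,dt+\varepsilon\int_{\mathbb R^n}(u_0+u_1)\psi(0,x)\,dx-\varepsilon\int_{\mathbb R^n}u_0\,\partial_t\psi(0,x)\,dx=\int_0^T\!\!\int_{\mathbb R^n}u\,(\partial_t^2-\partial_t-\Delta)\psi\,dx\,dt.$$ It is global if $T=\infty$. The lifespan estimate means that the bound holds for every $T$ such that a weak solution exists on $[0,T)$. *)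

theory Defs
  imports "HOL-Analysis.Analysis"
begin

section \<open>Square-integrable functions and the Fourier transform\<close>

text \<open>Elements of the function spaces are Borel functions (not classes modulo null sets).\<close>

definition L2_space :: "('a::euclidean_space \<Rightarrow> complex) set" where
  "L2_space = {f \<in> borel_measurable lborel. integrable lborel (\<lambda>x. (norm (f x))\<^sup>2)}"

text \<open>Fourier integral over the ball of radius \<open>R\<close>; an \<open>L\<^sup>2\<close> function is integrable there.\<close>

definition fourier_trunc :: "real \<Rightarrow> ('a::euclidean_space \<Rightarrow> complex) \<Rightarrow> 'a \<Rightarrow> complex" where
  "fourier_trunc R f \<xi> =
     complex_of_real ((2 * pi) powr (- real DIM('a) / 2)) *
     (LINT x:cball 0 R|lborel. cis (- (x \<bullet> \<xi>)) * f x)"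

text \<open>The Fourier transform on \<open>L\<^sup>2\<close> in the sense of Plancherel: \<open>g\<close> is the \<open>L\<^sup>2\<close>-limit of the
  truncated Fourier integrals of \<open>f\<close>. For every \<open>f\<close> in \<open>L\<^sup>2\<close> such a \<open>g\<close> exists and it is unique
  up to null sets, hence the formulation as a relation.\<close>

definition has_fourier_transform ::
    "('a::euclidean_space \<Rightarrow> complex) \<Rightarrow> ('a \<Rightarrow> complex) \<Rightarrow> bool" (infix "has'_fourier'_transform" 50)
  where
  "f has_fourier_transform g \<longleftrightarrow> f \<in> L2_space \<and> g \<in> L2_space \<and>
     ((\<lambda>R. \<integral>\<^sup>+\<xi>. ennreal ((norm (fourier_trunc R f \<xi> - g \<xi>))\<^sup>2) \<partial>lborel) \<longlongrightarrow> 0) at_top"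

text \<open>For \<open>s \<ge> 0\<close>, where \<open>H\<^sup>s\<close> is contained in \<open>L\<^sup>2\<close>.\<close>

definition sobolev_space :: "real \<Rightarrow> ('a::euclidean_space \<Rightarrow> complex) set" where
  "sobolev_space s = {f. \<exists>g. f has_fourier_transform g \<and>
     (\<lambda>\<xi>. complex_of_real ((1 + (norm \<xi>)\<^sup>2) powr (s / 2)) * g \<xi>) \<in> L2_space}"

text \<open>The part of the homogeneous Sobolev space of order \<open>\<sigma>\<close> that lies in \<open>L\<^sup>2\<close>.\<close>

definition homogeneous_sobolev_L2 :: "real \<Rightarrow> ('a::euclidean_space \<Rightarrow> complex) set" where
  "homogeneous_sobolev_L2 \<sigma> = {f. \<exists>g. f has_fourier_transform g \<and>
     (\<lambda>\<xi>. complex_of_real (norm \<xi> powr \<sigma>) * g \<xi>) \<in> L2_space}"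


section \<open>Smooth functions and differential operators\<close>

definition dir_deriv ::
    "'a::euclidean_space \<Rightarrow> ('a \<Rightarrow> real) \<Rightarrow> 'a \<Rightarrow> real" where
  "dir_deriv v f = (\<lambda>z. frechet_derivative f (at z) v)"

primrec C_k :: "nat \<Rightarrow> ('a::euclidean_space \<Rightarrow> real) \<Rightarrow> bool" where
  "C_k 0 f \<longleftrightarrow> continuous_on UNIV f"
| "C_k (Suc k) f \<longleftrightarrow> (\<forall>z. f differentiable (at z)) \<and> (\<forall>b\<in>Basis. C_k k (dir_deriv b f))"

definition smooth :: "('a::euclidean_space \<Rightarrow> real) \<Rightarrow> bool" where
  "smooth f \<longleftrightarrow> (\<forall>k. C_k k f)"

text \<open>Space-time points are pairs \<open>(t, x)\<close>.\<close>

definition time_deriv :: "(real \<times> 'a::euclidean_space \<Rightarrow> real) \<Rightarrow> real \<times> 'a \<Rightarrow> real" where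
  "time_deriv = dir_deriv (1, 0)"

definition space_laplacian :: "(real \<times> 'a::euclidean_space \<Rightarrow> real) \<Rightarrow> real \<times> 'a \<Rightarrow> real" where
  "space_laplacian \<psi> z = (\<Sum>b\<in>Basis. dir_deriv (0, b) (dir_deriv (0, b) \<psi>) z)"


section \<open>Weak solutions\<close>

definition strip :: "ereal \<Rightarrow> (real \<times> 'a::euclidean_space) set" where
  "strip T = {z. 0 \<le> fst z \<and> ereal (fst z) < T}"

definition Lp_loc_on ::
    "real \<Rightarrow> (real \<times> 'a::euclidean_space) set \<Rightarrow> (real \<times> 'a \<Rightarrow> complex) set" where
  "Lp_loc_on p D = {u. set_borel_measurable lborel D u \<and>
     (\<forall>K. compact K \<and> K \<subseteq> D \<longrightarrow> set_integrable lborel K (\<lambda>z. norm (u z) powr p))}"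

text \<open>Smoothness up to the boundary \<open>t = 0\<close> is expressed by a smooth extension to the whole
  space-time; the support may reach \<open>t = 0\<close> but stays away from \<open>t = T\<close>. Derivatives at points
  of the strip, including those with \<open>t = 0\<close>, do not depend on the extension.\<close>

definition test_functions :: "ereal \<Rightarrow> (real \<times> 'a::euclidean_space \<Rightarrow> real) set" where
  "test_functions T = {\<psi>. smooth \<psi> \<and>
     (\<exists>K. compact K \<and> K \<subseteq> strip T \<and> (\<forall>z \<in> strip T - K. \<psi> z = 0))}"

text \<open>Real-valued test functions suffice, also for complex-valued \<open>u\<close>, because the identity is
  linear in the test function.\<close>

definition weak_solution ::
    "real \<Rightarrow> ereal \<Rightarrow> real \<Rightarrow> ('a::euclidean_space \<Rightarrow> complex) \<Rightarrow> ('a \<Rightarrow> complex) \<Rightarrow>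
     (real \<times> 'a \<Rightarrow> complex) \<Rightarrow> bool" where
  "weak_solution p T \<epsilon> u0 u1 u \<longleftrightarrow> u \<in> Lp_loc_on p (strip T) \<and>
     (\<forall>\<psi> \<in> test_functions T.
        complex_of_real (LINT z:strip T|lborel. norm (u z) powr p * \<psi> z)
        + \<epsilon> *\<^sub>R (LINT x|lborel. \<psi> (0, x) *\<^sub>R (u0 x + u1 x))
        - \<epsilon> *\<^sub>R (LINT x|lborel. time_deriv \<psi> (0, x) *\<^sub>R u0 x)
        = (LINT z:strip T|lborel.
             (time_deriv (time_deriv \<psi>) z - time_deriv \<psi> z - space_laplacian \<psi> z) *\<^sub>R u z))"

end

theory Submission
  imports Defs "HOL-Probability.Probability"
begin

text \<open>Write \<open>f = u0 + u1\<close>. The equation is tested twice. A non-negative test function living on times up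
  to \<open>\<tau>\<close> and on \<open>norm x\<close> up to about \<open>K = sqrt \<tau>\<close> has non-negative Fourier transform, so the data term has a
  good sign and Young's inequality bounds the mass of \<open>norm u powr p\<close> in this region by a multiple of
  \<open>\<tau> powr (1 - p' + n / 2)\<close>. A second test function, living on times up to 1 and multiplied by
  \<open>1 + cos (a \<bullet> x)\<close>, sees the singularity of \<open>w\<close> at the frequency \<open>a\<close>: its data term is at least of
  order \<open>\<epsilon> * K powr (n / 2) / ln K\<close>. There the part \<open>(norm a)\<^sup>2\<close> of the Laplacian is not small, but only a time
  interval of length 1 is involved, and Young's inequality with a large weight against the first bound
  gives \<open>\<epsilon> * \<tau> powr (n / 4) / ln \<tau> \<le> C * \<tau> powr (n / 2 - (p' - 1) / p)\<close>, which bounds \<open>\<tau>\<close>.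

  Positivity on the Fourier side and compact support need not be reconciled: the spatial factor is
  a Gaussian of width \<open>K\<close> times a cutoff at radius \<open>N\<close>, all constants are uniform in \<open>N \<ge> K\<close>, and
  \<open>N\<close> tends to infinity before the Fourier transform is used. All cutoffs are made from
  \<open>exp (- 1 / x)\<close>, whose derivatives are dominated by its powers with exponent below 1; this is what
  Young's inequality needs.\<close>

section \<open>Smooth functions\<close>

lemma dir_deriv_eq:
  assumes "(f has_derivative f') (at z)"
  shows "dir_deriv v f z = f' v"
  using frechet_derivative_at[OF assms] by (simp add: dir_deriv_def)

lemma dir_deriv_eqI:
  assumes "\<And>z. (f has_derivative f' z) (at z)"
  shows "dir_deriv v f = (\<lambda>z. f' z v)"
  using dir_deriv_eq[OF assms] by (intro ext)

lemma C_k_SucI: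
  assumes "\<And>z. (f has_derivative f' z) (at z)" "\<And>b. b \<in> Basis \<Longrightarrow> C_k k (\<lambda>z. f' z b)"
  shows "C_k (Suc k) f"
  using assms(2) dir_deriv_eqI[OF assms(1)] assms(1) by (auto simp: differentiable_def)

lemma C_k_SucE:
  assumes "C_k (Suc k) f"
  shows "(f has_derivative (\<lambda>v. dir_deriv v f z)) (at z)" and "b \<in> Basis \<Longrightarrow> C_k k (dir_deriv b f)"
  using assms by (auto simp: dir_deriv_def frechet_derivative_works)

lemma C_k_Suc_imp: "C_k (Suc k) f \<Longrightarrow> C_k k f"
proof (induction k arbitrary: f)
  case 0
  then show ?case
    by (auto simp: continuous_on_eq_continuous_within intro!: differentiable_imp_continuous_within)
next
  case (Suc k)
  then show ?case unfolding C_k.simps(2)[of "Suc k"] C_k.simps(2)[of k] by blast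
qed

lemma C_k_const: "C_k k (\<lambda>z. c)"
proof (induction k arbitrary: c)
  case (Suc k)
  then show ?case by (intro C_k_SucI[where f' = "\<lambda>_ _. 0"]) auto
qed simp

lemma C_k_linear:
  assumes "bounded_linear f"
  shows "C_k k f"
proof (cases k)
  case 0
  then show ?thesis using assms by (simp add: linear_continuous_on)
next
  case (Suc j)
  then show ?thesis
    using C_k_SucI[OF bounded_linear_imp_has_derivative[OF assms]] C_k_const by blast
qed

lemma C_k_add: "C_k k f \<Longrightarrow> C_k k g \<Longrightarrow> C_k k (\<lambda>z. f z + g z)"
proof (induction k arbitrary: f g)
  case (Suc k)
  note df = C_k_SucE[OF Suc.prems(1)] and dg = C_k_SucE[OF Suc.prems(2)]
  show ?case
    by (rule C_k_SucI[OF has_derivative_add[OF df(1) dg(1)]]) (intro Suc.IH df(2) dg(2))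
qed (simp add: continuous_on_add continuous_on_mult)

lemma C_k_mult: "C_k k f \<Longrightarrow> C_k k g \<Longrightarrow> C_k k (\<lambda>z. f z * g z)"
proof (induction k arbitrary: f g)
  case (Suc k)
  note df = C_k_SucE[OF Suc.prems(1)] and dg = C_k_SucE[OF Suc.prems(2)]
  \<comment> \<open>The product rule leaves one factor of each summand undifferentiated;
    \<open>C_k_Suc_imp\<close> lowers the order of that factor to \<open>k\<close>.\<close>
  show ?case
    by (rule C_k_SucI[OF has_derivative_mult[OF df(1) dg(1)]])
       (intro C_k_add Suc.IH df(2) dg(2) C_k_Suc_imp[OF Suc.prems(1)] C_k_Suc_imp[OF Suc.prems(2)])
qed (simp add: continuous_on_add continuous_on_mult)

lemma smooth_const: "smooth (\<lambda>z. c)"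
  and smooth_add: "smooth f \<Longrightarrow> smooth g \<Longrightarrow> smooth (\<lambda>z. f z + g z)"
  and smooth_mult: "smooth f \<Longrightarrow> smooth g \<Longrightarrow> smooth (\<lambda>z. f z * g z)"
  and smooth_linear: "bounded_linear h \<Longrightarrow> smooth h"
  by (auto simp: smooth_def C_k_const C_k_add C_k_mult C_k_linear)

lemma smooth_sum: "(\<And>i. i \<in> I \<Longrightarrow> smooth (f i)) \<Longrightarrow> smooth (\<lambda>z. \<Sum>i\<in>I. f i z)"
  by (induction I rule: infinite_finite_induct) (auto simp: smooth_const smooth_add)

text \<open>Closing a family \<open>F\<close> under derivatives lets the induction go through without closed formulas
  for the higher derivatives.\<close>

lemma C_k_comp:
  fixes F :: "'i \<Rightarrow> real \<Rightarrow> real"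
  assumes F: "\<And>i y. (F i has_real_derivative (c1 i * F (j1 i) y + c2 i * F (j2 i) y)) (at y)"
    and q: "\<And>k. C_k k q"
  shows "C_k k (\<lambda>z. F i (q z))"
proof (induction k arbitrary: i)
  case 0
  have "continuous_on UNIV (F i)"
    using F by (auto simp: continuous_on_eq_continuous_within intro!: DERIV_isCont)
  moreover have "continuous_on UNIV q" using q[of 0] by simp
  ultimately show ?case
    by (auto intro: continuous_on_compose2)
next
  case (Suc k)
  let ?F' = "\<lambda>z. c1 i * F (j1 i) (q z) + c2 i * F (j2 i) (q z)"
  have *: "((\<lambda>z. F i (q z)) has_derivative (\<lambda>v. ?F' z * dir_deriv v q z)) (at z)" for z
    using has_derivative_compose[OF C_k_SucE(1)[OF q] F[unfolded has_field_derivative_def]] by simp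
  show ?case
    by (rule C_k_SucI[OF *]) (intro C_k_mult C_k_add C_k_const Suc C_k_SucE(2)[OF q])
qed

lemma smooth_comp:
  fixes F :: "'i \<Rightarrow> real \<Rightarrow> real"
  assumes "\<And>i y. (F i has_real_derivative (c1 i * F (j1 i) y + c2 i * F (j2 i) y)) (at y)"
    and "smooth q"
  shows "smooth (\<lambda>z. F i (q z))"
  using C_k_comp[of F c1 j1 c2 j2 q _ i, OF assms(1)] assms(2) unfolding smooth_def by blast

lemma smooth_exp:
  assumes "smooth q"
  shows "smooth (\<lambda>z. exp (q z))"
  using smooth_comp[of "\<lambda>_::unit. exp" "\<lambda>_. 1" id "\<lambda>_. 0" id] assms by simp

lemma smooth_cos:
  assumes "smooth q"
  shows "smooth (\<lambda>z. cos (q z))"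
  \<comment> \<open>\<open>True\<close> indexes cos and \<open>False\<close> indexes sin.
    Differentiation swaps them by \<open>Not\<close>, with the sign \<open>-1\<close> on leaving
    cos; the coefficient 0 switches off the second summand of the required derivative.\<close>
  using smooth_comp[of "\<lambda>b. if b then cos else sin" "\<lambda>b. if b then -1 else 1" Not "\<lambda>_. 0" Not q True]
    assms by (auto intro!: derivative_eq_intros)

section \<open>A flat cutoff\<close>

text \<open>The classical flat function exp (-1/x) is \<open>bump 0\<close>. The denominator
  \<open>x ^ m\<close> is built in because division by powers of x closes the family under
  differentiation, as \<open>smooth_comp\<close> requires.\<close>

definition bump :: "nat \<Rightarrow> real \<Rightarrow> real" where
  "bump m x = (if x > 0 then exp (- inverse x) / x ^ m else 0)"

lemma exp_neg_times_power_tendsto_0: "((\<lambda>x::real. exp (- inverse x) / x ^ m) \<longlongrightarrow> 0) (at_right 0)"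
proof -
  have "((\<lambda>x::real. x ^ m / exp x) \<longlongrightarrow> 0) at_top" by (rule tendsto_power_div_exp_0)
  then have "((\<lambda>x::real. inverse x ^ m / exp (inverse x)) \<longlongrightarrow> 0) (at_right 0)"
    by (rule filterlim_compose[OF _ filterlim_inverse_at_top_right])
  then show ?thesis by (simp add: exp_minus power_inverse field_simps)
qed

text \<open>At 0 the flatness of the exponential makes both one-sided difference quotients vanish.
  The explicit coefficients \<open>1\<close> and \<open>- real m\<close> give the statement the
  shape that \<open>smooth_comp\<close> expects.\<close>

lemma bump_has_real_derivative:
  "(bump m has_real_derivative (1 * bump (m + 2) y + (- real m) * bump (m + 1) y)) (at y)"
proof -
  consider "y > 0" | "y < 0" | "y = 0" by linarith
  then show ?thesis
  proof cases
    case 1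
    have "((\<lambda>x. exp (- inverse x) * inverse x ^ m) has_real_derivative
      exp (- inverse y) * (inverse y)\<^sup>2 * inverse y ^ m
        - exp (- inverse y) * (real m * inverse y ^ (m - 1) * (inverse y)\<^sup>2)) (at y)"
      using 1 by (auto intro!: derivative_eq_intros simp: power2_eq_square)
    \<comment> \<open>At \<open>m = 0\<close> the truncated \<open>m - 1\<close> does no harm, since
      both sides carry the factor 0.\<close>
    moreover have "real m * inverse y ^ (m - 1) * (inverse y)\<^sup>2 = real m * inverse y ^ (m + 1)"
      by (cases m) (auto simp: power2_eq_square)
    moreover have "exp (- inverse y) * (inverse y)\<^sup>2 * inverse y ^ m - exp (- inverse y) * (real m * inverse y ^ (m + 1))
      = 1 * bump (m + 2) y + (- real m) * bump (m + 1) y"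
      using 1 by (simp add: bump_def power_inverse field_simps power2_eq_square)
    ultimately have D: "((\<lambda>x. exp (- inverse x) * inverse x ^ m) has_real_derivative
      (1 * bump (m + 2) y + (- real m) * bump (m + 1) y)) (at y)"
      by metis
    show ?thesis
      by (rule has_field_derivative_transform_within_open[OF D, of "{0<..}"])
         (use 1 in \<open>auto simp: bump_def power_inverse divide_inverse\<close>)
  next
    case 2
    have "((\<lambda>x. 0) has_real_derivative 0) (at y)" by simp
    then have "(bump m has_real_derivative 0) (at y)"
      by (rule has_field_derivative_transform_within_open[of _ _ _ "{..<0}"]) (use 2 in \<open>auto simp: bump_def\<close>)
    then show ?thesis using 2 by (simp add: bump_def)
  next
    case 3
    \<comment> \<open>Since \<open>bump m 0 = 0\<close>, the difference quotient at 0 is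
      \<open>bump m x / x\<close>. To the right it is the function of exponent \<open>Suc m\<close>,
      to the left it is identically 0.\<close>
    have "((\<lambda>x. bump m x / x) \<longlongrightarrow> 0) (at_right 0)"
      by (rule Lim_transform_eventually[OF exp_neg_times_power_tendsto_0[of "Suc m"]])
         (auto simp: bump_def eventually_at_filter)
    moreover have "((\<lambda>x. bump m x / x) \<longlongrightarrow> 0) (at_left 0)"
      by (rule Lim_transform_eventually[OF tendsto_const])
         (auto simp: bump_def eventually_at_filter)
    ultimately have "((\<lambda>x. bump m x / x) \<longlongrightarrow> 0) (at 0)"
      by (simp add: filterlim_split_at)
    then show ?thesis using 3 by (simp add: has_field_derivative_iff bump_def)
  qed
qed

lemma smooth_bump: "smooth q \<Longrightarrow> smooth (\<lambda>z. bump m (q z))"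
  by (rule smooth_comp[OF bump_has_real_derivative])

lemma bump_nonneg: "0 \<le> bump m x" and bump_nonpos: "x \<le> 0 \<Longrightarrow> bump m x = 0"
  by (auto simp: bump_def)

text \<open>The exponential wins beyond some Y, and monotonicity of the power covers the rest. Two
  kinds of factors get absorbed this way: the powers of 1/x in \<open>bump\<close>, and the growth
  in x produced by differentiating a Gaussian.\<close>

lemma power_exp_bounded:
  assumes "k > 0"
  obtains C where "C > 0" "\<And>y::real. y \<ge> 0 \<Longrightarrow> (1 + y) ^ m * exp (- k * y) \<le> C"
proof -
  have "((\<lambda>y::real. (1 + y) ^ m * exp (- k * y)) \<longlongrightarrow> 0) at_top"
    using assms by real_asymp
  then have "eventually (\<lambda>y::real. (1 + y) ^ m * exp (- k * y) < 1) at_top"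
    by (rule order_tendstoD) simp
  then obtain Y where Y: "\<And>y. y \<ge> Y \<Longrightarrow> (1 + y) ^ m * exp (- k * y) < 1"
    by (auto simp: eventually_at_top_linorder)
  have "(1 + y) ^ m * exp (- k * y) \<le> 1 + (1 + \<bar>Y\<bar>) ^ m" if "y \<ge> 0" for y
  proof (cases "y \<ge> Y")
    case True
    then show ?thesis using Y[of y] zero_le_power[of "1 + \<bar>Y\<bar>" m] by linarith
  next
    case False
    then have "(1 + y) ^ m \<le> (1 + \<bar>Y\<bar>) ^ m" using that by (intro power_mono) auto
    moreover have "(1 + y) ^ m * exp (- k * y) \<le> (1 + y) ^ m * 1"
      using that assms by (intro mult_left_mono) auto
    ultimately show ?thesis by linarith
  qed
  moreover have "1 + (1 + \<bar>Y\<bar>) ^ m > 0" by (simp add: add_pos_nonneg)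
  ultimately show ?thesis using that by blast
qed

text \<open>With y = 1/x, split exp (-y) into exp (-(1 - \<theta>) y) and exp (-\<theta> y): the
  first absorbs y^m, the second is the power of \<open>bump 0\<close>. Some loss of exponent is
  unavoidable, as \<open>bump m x / bump 0 x\<close> is unbounded near 0 for m > 0.\<close>

lemma bump_le_powr:
  assumes "\<theta> < 1"
  obtains C where "C > 0" "\<And>x. bump m x \<le> C * bump 0 x powr \<theta>"
proof -
  obtain C where C: "C > 0" "\<And>y::real. y \<ge> 0 \<Longrightarrow> (1 + y) ^ m * exp (- (1 - \<theta>) * y) \<le> C"
    using power_exp_bounded[of "1 - \<theta>" m] assms by auto
  have "bump m x \<le> C * bump 0 x powr \<theta>" for x
  proof (cases "x > 0")
    case True
    define y where "y = inverse x"
    have y: "y > 0" using True by (simp add: y_def)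
    have "bump m x = y ^ m * exp (- (1 - \<theta>) * y) * exp (- \<theta> * y)"
      using True by (simp add: bump_def y_def field_simps flip: exp_add)
    also have "\<dots> \<le> (1 + y) ^ m * exp (- (1 - \<theta>) * y) * exp (- \<theta> * y)"
      using y by (intro mult_right_mono power_mono) auto
    also have "\<dots> \<le> C * exp (- \<theta> * y)"
      using C(2)[of y] y by (intro mult_right_mono) auto
    also have "exp (- \<theta> * y) = bump 0 x powr \<theta>"
      using True by (simp add: bump_def y_def powr_def)
    finally show ?thesis .
  qed (simp add: bump_def)
  then show ?thesis using that C(1) by blast
qed

section \<open>Gaussians and the Fourier transform\<close>

text \<open>After scaling this is the characteristic function of the standard normal
  distribution.\<close>

lemma gaussian_fourier_real:
  fixes t \<alpha> :: real
  assumes "0 < \<alpha>"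
  shows "has_bochner_integral lborel (\<lambda>y. complex_of_real (exp (- \<alpha> * y\<^sup>2)) * cis (- (t * y)))
    (complex_of_real (sqrt (pi / \<alpha>) * exp (- t\<^sup>2 / (4 * \<alpha>))))" (is "has_bochner_integral _ ?f ?I")
proof -
  \<comment> \<open>Replacing y by c y turns exp (-\<alpha> y^2) into exp (-y^2 / 2), the shape of
    the normal density.\<close>
  define c where "c = 1 / sqrt (2 * \<alpha>)"
  have c: "c > 0" "c\<^sup>2 = 1 / (2 * \<alpha>)" using assms by (simp_all add: c_def power_divide)
  let ?g = "\<lambda>y. std_normal_density y *\<^sub>R iexp (- t * c * y)"
  have int: "integrable lborel ?g"
    by (rule Bochner_Integration.integrable_bound[OF integrable_normal_density[of 1 0]]) auto
  have "integral\<^sup>L lborel ?g = char std_normal_distribution (- t * c)"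
    by (simp add: char_def integral_density)
  also have "\<dots> = complex_of_real (exp (- t\<^sup>2 / (4 * \<alpha>)))"
    using c by (simp add: char_std_normal_distribution power_mult_distrib)
  finally have "has_bochner_integral lborel ?g (complex_of_real (exp (- t\<^sup>2 / (4 * \<alpha>))))"
    using int by (simp add: has_bochner_integral_iff)
  from has_bochner_integral_mult_right[OF this, of "complex_of_real (sqrt (2 * pi))"]
  have "has_bochner_integral lborel (\<lambda>y. complex_of_real (sqrt (2 * pi)) * ?g y)
    (complex_of_real (sqrt (2 * pi) * exp (- t\<^sup>2 / (4 * \<alpha>))))" by simp
  moreover have "(\<lambda>y. complex_of_real (sqrt (2 * pi)) * ?g y) = (\<lambda>y. ?f (0 + c * y))"
    using c assms
    by (auto simp: fun_eq_iff std_normal_density_def scaleR_conv_of_real power_mult_distrib cis_conv_exp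
        mult_ac simp flip: of_real_mult)
  moreover have "complex_of_real (sqrt (2 * pi) * exp (- t\<^sup>2 / (4 * \<alpha>))) = ?I /\<^sub>R \<bar>c\<bar>"
    using assms by (simp add: c_def scaleR_conv_of_real real_sqrt_mult real_sqrt_divide)
  ultimately show ?thesis
    using c lborel_has_bochner_integral_real_affine_iff[of c ?f ?I 0] by simp
qed

text \<open>Lebesgue measure on a Euclidean space is the image of the product of one-dimensional
  Lebesgue measures over \<open>Basis\<close>, so integrals of products over the coordinates
  factor.\<close>

lemma has_bochner_integral_lborel_prod:
  fixes f :: "'a::euclidean_space \<Rightarrow> real \<Rightarrow> complex"
  assumes "\<And>b. b \<in> Basis \<Longrightarrow> has_bochner_integral lborel (f b) (I b)"
  shows "has_bochner_integral lborel (\<lambda>x::'a. \<Prod>b\<in>Basis. f b (x \<bullet> b)) (\<Prod>b\<in>Basis. I b)"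
proof -
  interpret product_sigma_finite "\<lambda>_::'a. lborel :: real measure" by standard
  have int: "integrable lborel (f b)" and I: "integral\<^sup>L lborel (f b) = I b" if "b \<in> Basis" for b
    using assms[OF that] by (auto simp: has_bochner_integral_iff)
  have *: "(\<Sum>c\<in>Basis. z c *\<^sub>R c) \<bullet> b = z b" if "b \<in> Basis" for z :: "'a \<Rightarrow> real" and b
    using that by (simp add: inner_sum_left inner_Basis if_distrib cong: if_cong)
  have "has_bochner_integral (\<Pi>\<^sub>M b\<in>Basis. lborel) (\<lambda>z. \<Prod>b\<in>Basis. f b (z b)) (\<Prod>b\<in>Basis. I b)"
    using product_integrable_prod[OF finite_Basis int] product_integral_prod[OF finite_Basis int] I
    by (simp add: has_bochner_integral_iff)
  moreover have "(\<lambda>x::'a. f b (x \<bullet> b)) \<in> borel_measurable borel" if "b \<in> Basis" for b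
  proof (rule measurable_compose[of "\<lambda>x. x \<bullet> b" _ borel])
    show "(\<lambda>x. x \<bullet> b) \<in> borel_measurable borel"
      by (intro borel_measurable_continuous_onI continuous_intros)
    show "f b \<in> borel_measurable borel" using borel_measurable_integrable[OF int[OF that]] by simp
  qed
  then have "(\<lambda>x::'a. \<Prod>b\<in>Basis. f b (x \<bullet> b)) \<in> borel_measurable borel"
    by (rule borel_measurable_prod)
  ultimately show ?thesis
    by (subst lborel_eq, subst has_bochner_integral_distr) (simp_all add: * cong: prod.cong)
qed

lemma gaussian_fourier:
  fixes x :: "'a::euclidean_space"
  assumes "0 < \<alpha>"
  shows "has_bochner_integral lborel (\<lambda>\<xi>. complex_of_real (exp (- \<alpha> * (norm \<xi>)\<^sup>2)) * cis (- (x \<bullet> \<xi>)))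
    (complex_of_real ((pi / \<alpha>) powr (DIM('a) / 2) * exp (- (norm x)\<^sup>2 / (4 * \<alpha>))))"
proof -
  have sq: "(norm y)\<^sup>2 = (\<Sum>b\<in>Basis. (y \<bullet> b)\<^sup>2)" for y :: 'a
    by (subst power2_norm_eq_inner, subst euclidean_inner) (simp add: power2_eq_square)
  have cis_sum: "cis (\<Sum>b\<in>B. k b) = (\<Prod>b\<in>B. cis (k b))" for B :: "'a set" and k
    by (induction B rule: infinite_finite_induct) (auto simp flip: cis_mult)
  have "complex_of_real (exp (- \<alpha> * (norm \<xi>)\<^sup>2)) * cis (- (x \<bullet> \<xi>)) =
      (\<Prod>b\<in>Basis. complex_of_real (exp (- \<alpha> * (\<xi> \<bullet> b)\<^sup>2)) * cis (- ((x \<bullet> b) * (\<xi> \<bullet> b))))" for \<xi> :: 'a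
    unfolding sq by (simp add: exp_sum cis_sum prod.distrib sum_distrib_left euclidean_inner[of x \<xi>] flip: sum_negf)
  moreover have "(\<Prod>b\<in>(Basis::'a set). complex_of_real (sqrt (pi / \<alpha>) * exp (- (x \<bullet> b)\<^sup>2 / (4 * \<alpha>)))) =
      complex_of_real ((pi / \<alpha>) powr (DIM('a) / 2) * exp (- (norm x)\<^sup>2 / (4 * \<alpha>)))"
  proof -
    have "sqrt (pi / \<alpha>) ^ DIM('a) = (pi / \<alpha>) powr (DIM('a) / 2)"
      using assms by (simp add: powr_half_sqrt[symmetric] powr_power)
    then show ?thesis
      unfolding sq of_real_prod[symmetric] by (simp add: prod.distrib exp_sum sum_divide_distrib flip: sum_negf)
  qed
  ultimately show ?thesis
    using has_bochner_integral_lborel_prod[of "\<lambda>b y. complex_of_real (exp (- \<alpha> * y\<^sup>2)) * cis (- ((x \<bullet> b) * y))"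
        "\<lambda>b. complex_of_real (sqrt (pi / \<alpha>) * exp (- (x \<bullet> b)\<^sup>2 / (4 * \<alpha>)))", OF gaussian_fourier_real[OF assms]]
    by (simp only:)
qed

section \<open>Pairing a function with its Plancherel transform\<close>

lemma integrable_mult_of_squares:
  fixes f g :: "'a \<Rightarrow> 'b::{real_normed_algebra,second_countable_topology,banach}"
  assumes "integrable M (\<lambda>x. (norm (f x))\<^sup>2)" "integrable M (\<lambda>x. (norm (g x))\<^sup>2)"
    and [measurable]: "f \<in> borel_measurable M" "g \<in> borel_measurable M"
  shows "integrable M (\<lambda>x. f x * g x)"
proof (rule Bochner_Integration.integrable_bound[OF Bochner_Integration.integrable_add[OF assms(1,2)]])
  have "norm (f x * g x) \<le> (norm (f x))\<^sup>2 + (norm (g x))\<^sup>2" for x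
    using norm_mult_ineq[of "f x" "g x"] sum_squares_bound[of "norm (f x)" "norm (g x)"]
      mult_nonneg_nonneg[OF norm_ge_zero[of "f x"] norm_ge_zero[of "g x"]] by linarith
  then show "AE x in M. norm (f x * g x) \<le> norm ((norm (f x))\<^sup>2 + (norm (g x))\<^sup>2)"
    by (simp add: order_trans[OF _ abs_ge_self])
qed measurable

lemma L2_spaceD:
  assumes "f \<in> L2_space"
  shows "f \<in> borel_measurable borel" "integrable lborel (\<lambda>x. (norm (f x))\<^sup>2)"
  using assms by (auto simp: L2_space_def)

lemma L2_set_integrable:
  assumes "f \<in> L2_space"
  shows "integrable lborel (\<lambda>x. complex_of_real (indicator (cball 0 R) x) * f x)"
proof (rule integrable_mult_of_squares)
  show "integrable lborel (\<lambda>x::'a. (norm (complex_of_real (indicator (cball 0 R) x)))\<^sup>2)"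
    by (rule Bochner_Integration.integrable_cong[OF refl, THEN iffD1, OF _ integrable_real_indicator[of "cball 0 R"]])
       (auto simp: indicator_def emeasure_bounded_finite[OF bounded_cball, simplified])
  show "(\<lambda>x::'a. complex_of_real (indicator (cball 0 R) x)) \<in> borel_measurable lborel"
    by (rule measurable_compose[OF borel_measurable_indicator[of "cball 0 R"] borel_measurable_of_real]) auto
qed (use L2_spaceD[OF assms] in auto)

text \<open>On a ball f is integrable, so Fubini's theorem applies to f(x) g(\<xi>) cis (-(x
  \<bullet> \<xi>)): one order of integration produces h, the other the truncated transform of
  f.\<close>

lemma fourier_trunc_pairing:
  fixes f g :: "'a::euclidean_space \<Rightarrow> complex"
  assumes f: "f \<in> L2_space" and g: "integrable lborel g"
    and h: "\<And>x. h x = (LINT \<xi>|lborel. g \<xi> * cis (- (x \<bullet> \<xi>)))"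
  shows "integrable lborel (\<lambda>\<xi>. g \<xi> * fourier_trunc R f \<xi>)"
    and "(LINT x:cball 0 R|lborel. f x * h x) =
      complex_of_real ((2 * pi) powr (DIM('a) / 2)) * (LINT \<xi>|lborel. g \<xi> * fourier_trunc R f \<xi>)"
proof -
  define F where "F x = complex_of_real (indicator (cball 0 R) x) * f x" for x
  have F: "integrable lborel F"
    unfolding F_def by (rule L2_set_integrable[OF f])
  note [measurable] = borel_measurable_integrable[OF F] borel_measurable_integrable[OF g]
  let ?H = "\<lambda>(x, \<xi>). F x * g \<xi> * cis (- (x \<bullet> \<xi>))"
  have meas: "?H \<in> borel_measurable (lborel \<Otimes>\<^sub>M lborel)"
    unfolding cis_conv_exp by measurable
  have int: "integrable (lborel \<Otimes>\<^sub>M lborel) ?H"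
  proof (rule lborel_pair.Fubini_integrable[OF meas])
    have "(LINT \<xi>|lborel. norm (?H (x, \<xi>))) = norm (F x) * (LINT \<xi>|lborel. norm (g \<xi>))" for x
      by (simp add: norm_mult)
    then show "integrable lborel (\<lambda>x. LINT \<xi>|lborel. norm (?H (x, \<xi>)))"
      using F by simp
    have "integrable lborel (\<lambda>\<xi>. F x * g \<xi> * cis (- (x \<bullet> \<xi>)))" for x
      by (rule Bochner_Integration.integrable_bound[OF integrable_mult_right[OF g, of "F x"]])
         (auto simp: norm_mult cis_conv_exp)
    then show "AE x in lborel. integrable lborel (\<lambda>\<xi>. ?H (x, \<xi>))" by simp
  qed
  \<comment> \<open>The factor that undoes the normalisation in
    \<open>fourier_trunc\<close>.\<close>
  define k where "k = complex_of_real ((2 * pi) powr (DIM('a) / 2))"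
  have k: "k * complex_of_real ((2 * pi) powr (- real DIM('a) / 2)) = 1"
    by (simp add: k_def flip: of_real_mult powr_add)
  have tr: "k * fourier_trunc R f \<xi> = (LINT x|lborel. F x * cis (- (x \<bullet> \<xi>)))" for \<xi>
  proof -
    have "(LINT x|lborel. F x * cis (- (x \<bullet> \<xi>))) = (LINT x:cball 0 R|lborel. cis (- (x \<bullet> \<xi>)) * f x)"
      unfolding set_lebesgue_integral_def F_def
      by (intro Bochner_Integration.integral_cong) (auto simp: scaleR_conv_of_real)
    then show ?thesis unfolding fourier_trunc_def mult.assoc[symmetric] k by simp
  qed
  have eq: "(LINT x|lborel. ?H (x, \<xi>)) = k * (g \<xi> * fourier_trunc R f \<xi>)" for \<xi>
  proof -
    have "(LINT x|lborel. ?H (x, \<xi>)) = (LINT x|lborel. g \<xi> * (F x * cis (- (x \<bullet> \<xi>))))"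
      by (simp add: mult_ac)
    also have "\<dots> = g \<xi> * (k * fourier_trunc R f \<xi>)" unfolding tr by simp
    finally show ?thesis by (simp add: mult_ac)
  qed
  have "integrable lborel (\<lambda>\<xi>. k * (g \<xi> * fourier_trunc R f \<xi>))"
    using lborel_pair.integrable_snd[OF int] unfolding eq[symmetric] by (simp add: split_beta')
  moreover have "k \<noteq> 0" using k by auto
  ultimately show "integrable lborel (\<lambda>\<xi>. g \<xi> * fourier_trunc R f \<xi>)"
    using integrable_mult_right[of "inverse k" lborel "\<lambda>\<xi>. k * (g \<xi> * fourier_trunc R f \<xi>)"]
    by (simp add: mult.assoc[symmetric])
  have "(LINT x:cball 0 R|lborel. f x * h x) = (LINT x|lborel. (LINT \<xi>|lborel. ?H (x, \<xi>)))"
    unfolding set_lebesgue_integral_def F_def h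
    by (simp add: scaleR_conv_of_real mult.assoc)
  also have "\<dots> = (LINT \<xi>|lborel. (LINT x|lborel. ?H (x, \<xi>)))"
    using lborel_pair.Fubini_integral[of "\<lambda>x \<xi>. ?H (x, \<xi>)"] int by simp
  also have "\<dots> = k * (LINT \<xi>|lborel. g \<xi> * fourier_trunc R f \<xi>)"
    unfolding eq by simp
  finally show "(LINT x:cball 0 R|lborel. f x * h x) =
      complex_of_real ((2 * pi) powr (DIM('a) / 2)) * (LINT \<xi>|lborel. g \<xi> * fourier_trunc R f \<xi>)"
    unfolding k_def .
qed

text \<open>In the truncated identity the radius R tends to infinity: the frequency side converges
  by Cauchy-Schwarz and the L2 convergence of the truncated transforms, the spatial side by
  dominated convergence with majorant \<open>norm (f x * h x)\<close>.\<close>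

lemma fourier_transform_pairing:
  fixes f g w :: "'a::euclidean_space \<Rightarrow> complex"
  assumes f: "f has_fourier_transform w"
    and g: "integrable lborel g" "integrable lborel (\<lambda>\<xi>. (norm (g \<xi>))\<^sup>2)"
    and h: "\<And>x. h x = (LINT \<xi>|lborel. g \<xi> * cis (- (x \<bullet> \<xi>)))"
    and fh: "integrable lborel (\<lambda>x. f x * h x)"
  shows "integrable lborel (\<lambda>\<xi>. g \<xi> * w \<xi>)"
    and "(LINT x|lborel. f x * h x) =
      complex_of_real ((2 * pi) powr (DIM('a) / 2)) * (LINT \<xi>|lborel. g \<xi> * w \<xi>)"
proof -
  define k where "k = complex_of_real ((2 * pi) powr (DIM('a) / 2))"
  have fL: "f \<in> L2_space" and wL: "w \<in> L2_space"
    and lim: "((\<lambda>R. \<integral>\<^sup>+\<xi>. ennreal ((norm (fourier_trunc R f \<xi> - w \<xi>))\<^sup>2) \<partial>lborel) \<longlongrightarrow> 0) at_top"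
    using f by (auto simp: has_fourier_transform_def)
  note [measurable] = L2_spaceD(1)[OF fL] L2_spaceD(1)[OF wL] borel_measurable_integrable[OF g(1)]
  show gw: "integrable lborel (\<lambda>\<xi>. g \<xi> * w \<xi>)"
    using L2_spaceD[OF wL] g by (intro integrable_mult_of_squares) auto
  note tr = fourier_trunc_pairing[OF fL g(1) h]
  \<comment> \<open>Cauchy-Schwarz below asks for measurability in \<xi>; it follows from joint
    measurability of the integrand in \<xi> and x.\<close>
  have [measurable]: "fourier_trunc R f \<in> borel_measurable borel" for R
  proof -
    have "(\<lambda>z::'a \<times> 'a. cis (- (snd z \<bullet> fst z))) \<in> borel_measurable (borel \<Otimes>\<^sub>M lborel)"
      unfolding measurable_cong_sets[OF sets_pair_measure_cong[OF refl sets_lborel] refl] borel_prod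
        cis_conv_exp
      by (intro borel_measurable_continuous_onI continuous_intros)
    then have "(\<lambda>(\<xi>, x). indicat_real (cball 0 R) x *\<^sub>R (cis (- (x \<bullet> \<xi>)) * f x)) \<in> borel_measurable (borel \<Otimes>\<^sub>M lborel)"
      unfolding split_beta'
      by (intro borel_measurable_scaleR borel_measurable_times measurable_compose[OF measurable_snd]
          borel_measurable_indicator) auto
    from lborel.borel_measurable_lebesgue_integral[OF this]
    show ?thesis unfolding fourier_trunc_def set_lebesgue_integral_def by measurable
  qed
  let ?G = "\<integral>\<^sup>+\<xi>. ennreal ((norm (g \<xi>))\<^sup>2) \<partial>lborel"
  let ?E = "\<lambda>R. \<integral>\<^sup>+\<xi>. ennreal ((norm (fourier_trunc R f \<xi> - w \<xi>))\<^sup>2) \<partial>lborel"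
  let ?D = "\<lambda>R. (LINT \<xi>|lborel. g \<xi> * fourier_trunc R f \<xi>) - (LINT \<xi>|lborel. g \<xi> * w \<xi>)"
  have bound: "ennreal ((norm (?D R))\<^sup>2) \<le> ?G * ?E R" for R
  proof -
    have "?D R = (LINT \<xi>|lborel. g \<xi> * (fourier_trunc R f \<xi> - w \<xi>))"
      using tr(1) gw by (simp add: algebra_simps)
    then have "ennreal (norm (?D R)) \<le> (\<integral>\<^sup>+\<xi>. ennreal (norm (g \<xi> * (fourier_trunc R f \<xi> - w \<xi>))) \<partial>lborel)"
      using integral_norm_bound_ennreal[of lborel "\<lambda>\<xi>. g \<xi> * (fourier_trunc R f \<xi> - w \<xi>)"] tr(1) gw
      by (simp add: algebra_simps)
    also have "\<dots> = (\<integral>\<^sup>+\<xi>. ennreal (norm (g \<xi>)) * ennreal (norm (fourier_trunc R f \<xi> - w \<xi>)) \<partial>lborel)"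
      by (simp add: norm_mult ennreal_mult)
    finally have "(ennreal (norm (?D R)))\<^sup>2 \<le> \<dots>\<^sup>2" by (rule power_mono) simp
    also have "\<dots> \<le> (\<integral>\<^sup>+\<xi>. (ennreal (norm (g \<xi>)))\<^sup>2 \<partial>lborel)
        * (\<integral>\<^sup>+\<xi>. (ennreal (norm (fourier_trunc R f \<xi> - w \<xi>)))\<^sup>2 \<partial>lborel)"
      by (rule Cauchy_Schwarz_nn_integral) measurable
    finally show ?thesis by (simp add: ennreal_power)
  qed
  \<comment> \<open>This limit in \<open>ennreal\<close> needs the constant \<open>?G\<close> to be
    finite, that is, g to be square integrable.\<close>
  have lim0: "((\<lambda>R. ?G * ?E R) \<longlongrightarrow> ?G * 0) at_top"
    using integrableD(2)[OF g(2)] by (intro ennreal_tendsto_cmult lim) (simp add: less_top)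
  have "((\<lambda>R. ennreal ((norm (?D R))\<^sup>2)) \<longlongrightarrow> ennreal 0) at_top"
  proof (rule tendsto_sandwich)
    show "\<forall>\<^sub>F R in at_top. 0 \<le> ennreal ((norm (?D R))\<^sup>2)" by (rule always_eventually) simp
    show "\<forall>\<^sub>F R in at_top. ennreal ((norm (?D R))\<^sup>2) \<le> ?G * ?E R"
      by (rule always_eventually, rule allI, rule bound)
    show "((\<lambda>R. ?G * ?E R) \<longlongrightarrow> ennreal 0) at_top" using lim0 unfolding mult_zero_right ennreal_0 .
    show "((\<lambda>R. 0) \<longlongrightarrow> ennreal 0) at_top" by simp
  qed
  then have "((\<lambda>R. (norm (?D R))\<^sup>2) \<longlongrightarrow> 0) at_top"
    by (subst (asm) tendsto_ennreal_iff) (intro always_eventually allI zero_le_power2 order_refl)+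
  from tendsto_real_sqrt[OF this]
  have "(?D \<longlongrightarrow> 0) at_top" by (simp add: tendsto_norm_zero_iff)
  then have "((\<lambda>R. LINT \<xi>|lborel. g \<xi> * fourier_trunc R f \<xi>) \<longlongrightarrow> (LINT \<xi>|lborel. g \<xi> * w \<xi>)) at_top"
    by (simp add: LIM_zero_iff)
  from tendsto_mult[OF tendsto_const[of k] this]
  have 1: "((\<lambda>R. LINT x:cball 0 R|lborel. f x * h x) \<longlongrightarrow> k * (LINT \<xi>|lborel. g \<xi> * w \<xi>)) at_top"
    unfolding tr(2) k_def .
  have "((\<lambda>R. LINT x:cball 0 R|lborel. f x * h x) \<longlongrightarrow> (LINT x|lborel. f x * h x)) at_top"
    unfolding set_lebesgue_integral_def
  proof (rule integral_dominated_convergence_at_top[OF _ _ integrable_norm[OF fh]])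
    show "(\<lambda>x. f x * h x) \<in> borel_measurable lborel" using fh by auto
    show "\<forall>\<^sub>F R in at_top. AE x in lborel. norm (indicat_real (cball 0 R) x *\<^sub>R (f x * h x)) \<le> norm (f x * h x)"
      by (auto simp: indicator_def intro!: always_eventually)
    have "\<forall>\<^sub>F R in at_top. indicat_real (cball 0 R) x *\<^sub>R (f x * h x) = f x * h x" for x
      using eventually_ge_at_top[of "norm x"] by eventually_elim (auto simp: indicator_def)
    then show "AE x in lborel. ((\<lambda>R. indicat_real (cball 0 R) x *\<^sub>R (f x * h x)) \<longlongrightarrow> f x * h x) at_top"
      by (intro AE_I2 tendsto_eventually) auto
    show "(\<lambda>x. indicat_real (cball 0 R) x *\<^sub>R (f x * h x)) \<in> borel_measurable lborel" for R
      using borel_measurable_integrable[OF fh] by (intro borel_measurable_scaleR borel_measurable_indicator) auto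
  qed
  from tendsto_unique[OF _ this 1]
  show "(LINT x|lborel. f x * h x) =
      complex_of_real ((2 * pi) powr (DIM('a) / 2)) * (LINT \<xi>|lborel. g \<xi> * w \<xi>)"
    by (simp add: k_def)
qed

section \<open>Pairing with modulated Gaussians and the lower bound at the singular
  frequency\<close>

lemma integral_gaussian:
  assumes "0 < \<alpha>"
  shows "has_bochner_integral lborel (\<lambda>x::'a::euclidean_space. exp (- \<alpha> * (norm x)\<^sup>2)) ((pi / \<alpha>) powr (DIM('a) / 2))"
proof -
  have "has_bochner_integral lborel (\<lambda>x::'a. complex_of_real (exp (- \<alpha> * (norm x)\<^sup>2)))
      (complex_of_real ((pi / \<alpha>) powr (DIM('a) / 2)))"
    using gaussian_fourier[OF assms, of "0::'a"] by simp
  then show ?thesis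
    unfolding has_bochner_integral_iff
    using integral_complex_of_real[of lborel "\<lambda>x::'a. exp (- \<alpha> * (norm x)\<^sup>2)"]
    by (simp only: complex_of_real_integrable_eq of_real_eq_iff) 
qed

lemma integrable_gaussian:
  "0 < \<alpha> \<Longrightarrow> integrable lborel (\<lambda>x::'a::euclidean_space. exp (- \<alpha> * (norm x)\<^sup>2))"
  using integral_gaussian by (auto simp: has_bochner_integral_iff)

lemma integrable_L2_mult_gaussian:
  fixes f :: "'a::euclidean_space \<Rightarrow> complex"
  assumes "f \<in> L2_space" "K > 0"
  shows "integrable lborel (\<lambda>x. f x * complex_of_real (exp (- (norm x)\<^sup>2 / K\<^sup>2)))"
proof (rule integrable_mult_of_squares)
  show "integrable lborel (\<lambda>x::'a. (norm (complex_of_real (exp (- (norm x)\<^sup>2 / K\<^sup>2))))\<^sup>2)"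
    using integrable_gaussian[of "2 / K\<^sup>2", where 'a = 'a] assms(2)
    by (simp add: power2_eq_square flip: exp_add)
qed (use L2_spaceD[OF assms(1)] in auto)

text \<open>Multiplication by the character cis (-(x \<bullet> v)) moves the transformed Gaussian to
  the centre v. Pairing f with a modulated Gaussian of width K thus averages w near v at scale 1/K,
  which is how a singularity of w becomes visible.\<close>

lemma gaussian_modulated_pairing:
  fixes f w :: "'a::euclidean_space \<Rightarrow> complex"
  assumes f: "f has_fourier_transform w" and K: "0 < K"
  defines "G \<equiv> \<lambda>x::'a. complex_of_real (exp (- (norm x)\<^sup>2 / K\<^sup>2))"
    and "\<Gamma> \<equiv> \<lambda>v \<xi>::'a. complex_of_real (exp (- (K\<^sup>2 / 4) * (norm (\<xi> - v))\<^sup>2))"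
  shows "integrable lborel (\<lambda>\<xi>. \<Gamma> v \<xi> * w \<xi>)"
    and "integrable lborel (\<lambda>x. f x * (G x * cis (- (x \<bullet> v))))"
    and "(LINT x|lborel. f x * (G x * cis (- (x \<bullet> v)))) =
      complex_of_real ((K\<^sup>2 / 2) powr (DIM('a) / 2)) * (LINT \<xi>|lborel. \<Gamma> v \<xi> * w \<xi>)"
proof -
  have fL: "f \<in> L2_space" using f by (simp add: has_fourier_transform_def)
  \<comment> \<open>Reciprocal of the total mass of the frequency Gaussian; it makes the Fourier
    integral of \<open>?g\<close> below exactly \<open>G\<close> times the character.\<close>
  define k where "k = (K\<^sup>2 / (4 * pi)) powr (DIM('a) / 2)"
  have k: "k > 0" and k': "k * ((4 * pi) / K\<^sup>2) powr (DIM('a) / 2) = 1"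
    using K by (simp_all add: k_def flip: powr_mult)
  \<comment> \<open>Translation invariance of Lebesgue measure, needed because
    \<open>gaussian_fourier\<close> is centred at 0.\<close>
  have shift: "has_bochner_integral lborel F I"
    if "has_bochner_integral lborel (\<lambda>\<xi>. F (v + \<xi>)) I" for F :: "'a \<Rightarrow> 'b::{banach,second_countable_topology}" and I
  proof -
    have F: "integrable lborel (\<lambda>\<xi>. F (v + \<xi>))" using that by (simp add: has_bochner_integral_iff)
    have "(\<lambda>\<xi>. F (v + (- v + \<xi>))) \<in> borel_measurable borel"
      by (rule measurable_compose[of "\<lambda>\<xi>. - v + \<xi>" borel borel])
         (use borel_measurable_integrable[OF F] in auto)
    then show ?thesis
      by (subst lborel_distr_plus[of v, symmetric], subst has_bochner_integral_distr) (simp_all add: that)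
  qed
  let ?g = "\<lambda>\<xi>. complex_of_real k * \<Gamma> v \<xi>"
  have h: "has_bochner_integral lborel (\<lambda>\<xi>. ?g \<xi> * cis (- (x \<bullet> \<xi>))) (G x * cis (- (x \<bullet> v)))" for x
  proof (rule shift)
    have cis_eq: "cis (- (x \<bullet> (v + \<xi>))) = cis (- (x \<bullet> v)) * cis (- (x \<bullet> \<xi>))" for \<xi>
      by (simp add: inner_add_right cis_mult)
    have "?g (v + \<xi>) * cis (- (x \<bullet> (v + \<xi>))) =
      (k * cis (- (x \<bullet> v))) * (complex_of_real (exp (- (K\<^sup>2 / 4) * (norm \<xi>)\<^sup>2)) * cis (- (x \<bullet> \<xi>)))" for \<xi>
      unfolding cis_eq by (simp add: \<Gamma>_def mult_ac)
    moreover have "(k * cis (- (x \<bullet> v))) * complex_of_real ((pi / (K\<^sup>2 / 4)) powr (DIM('a) / 2)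
      * exp (- (norm x)\<^sup>2 / (4 * (K\<^sup>2 / 4)))) = G x * cis (- (x \<bullet> v))"
    proof -
      have "k * ((pi / (K\<^sup>2 / 4)) powr (DIM('a) / 2) * exp (- (norm x)\<^sup>2 / (4 * (K\<^sup>2 / 4)))) = exp (- (norm x)\<^sup>2 / K\<^sup>2)"
        using k' by (simp add: mult.assoc[symmetric] mult.commute)
      then have "complex_of_real k * complex_of_real ((pi / (K\<^sup>2 / 4)) powr (DIM('a) / 2)
        * exp (- (norm x)\<^sup>2 / (4 * (K\<^sup>2 / 4)))) = G x"
        unfolding G_def of_real_mult[symmetric] by (rule arg_cong)
      moreover have "complex_of_real k * cis (- (x \<bullet> v)) * z = (complex_of_real k * z) * cis (- (x \<bullet> v))" for z
        by (simp only: mult_ac)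
      ultimately show ?thesis by (simp only:)
    qed
    ultimately show "has_bochner_integral lborel (\<lambda>\<xi>. ?g (v + \<xi>) * cis (- (x \<bullet> (v + \<xi>)))) (G x * cis (- (x \<bullet> v)))"
      using has_bochner_integral_mult_right[OF gaussian_fourier[of "K\<^sup>2 / 4" x], of "k * cis (- (x \<bullet> v))"] K
      by (simp only: zero_less_power zero_less_divide_iff) simp
  qed
  have "integrable lborel ?g"
    using h[of 0] by (simp add: has_bochner_integral_iff)
  moreover have "integrable lborel (\<lambda>\<xi>. (norm (?g \<xi>))\<^sup>2)"
  proof -
    have "integrable lborel (\<lambda>\<xi>. k\<^sup>2 * exp (- (K\<^sup>2 / 2) * (norm (v + \<xi> - v))\<^sup>2))"
      using integrable_gaussian[of "K\<^sup>2 / 2", where 'a = 'a] K by simp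
    then have "integrable lborel (\<lambda>\<xi>. k\<^sup>2 * exp (- (K\<^sup>2 / 2) * (norm (\<xi> - v))\<^sup>2))"
      using shift[of "\<lambda>\<xi>. k\<^sup>2 * exp (- (K\<^sup>2 / 2) * (norm (\<xi> - v))\<^sup>2)"] by (simp add: has_bochner_integral_iff)
    moreover have "(norm (?g \<xi>))\<^sup>2 = k\<^sup>2 * exp (- (K\<^sup>2 / 2) * (norm (\<xi> - v))\<^sup>2)" for \<xi>
      using k by (simp add: \<Gamma>_def norm_mult power_mult_distrib power2_eq_square[of "exp _"] flip: exp_add)
    ultimately show ?thesis by presburger
  qed
  moreover show int: "integrable lborel (\<lambda>x. f x * (G x * cis (- (x \<bullet> v))))"
    using integrable_L2_mult_gaussian[OF fL K] unfolding G_def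
    by (rule Bochner_Integration.integrable_bound)
       (use L2_spaceD(1)[OF fL] in \<open>auto simp: norm_mult cis_conv_exp\<close>)
  ultimately have *: "integrable lborel (\<lambda>\<xi>. ?g \<xi> * w \<xi>)" "(LINT x|lborel. f x * (G x * cis (- (x \<bullet> v)))) =
      complex_of_real ((2 * pi) powr (DIM('a) / 2)) * (LINT \<xi>|lborel. ?g \<xi> * w \<xi>)"
    using fourier_transform_pairing[OF f _ _ has_bochner_integral_integral_eq[OF h, symmetric]] by auto
  show "integrable lborel (\<lambda>\<xi>. \<Gamma> v \<xi> * w \<xi>)"
    using integrable_mult_right[of "inverse (complex_of_real k)", OF *(1)] k by (simp add: mult.assoc[symmetric])
  have "(2 * pi) powr (DIM('a) / 2) * k = (K\<^sup>2 / 2) powr (DIM('a) / 2)"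
    by (simp add: k_def flip: powr_mult)
  moreover have "(LINT \<xi>|lborel. ?g \<xi> * w \<xi>) = k * (LINT \<xi>|lborel. \<Gamma> v \<xi> * w \<xi>)"
    by (simp add: mult.assoc)
  ultimately show "(LINT x|lborel. f x * (G x * cis (- (x \<bullet> v)))) =
      complex_of_real ((K\<^sup>2 / 2) powr (DIM('a) / 2)) * (LINT \<xi>|lborel. \<Gamma> v \<xi> * w \<xi>)"
    unfolding *(2) by (simp flip: of_real_mult)
qed

lemma Re_complex_of_real_mult: "Re (complex_of_real x * z) = x * Re z"
  by simp

lemma gaussian_modulated_pairing_Re:
  fixes f w :: "'a::euclidean_space \<Rightarrow> complex"
  assumes f: "f has_fourier_transform w" and K: "0 < K"
  shows "integrable lborel (\<lambda>\<xi>. exp (- (K\<^sup>2 / 4) * (norm (\<xi> - v))\<^sup>2) * Re (w \<xi>))"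
    and "Re (LINT x|lborel. f x * (complex_of_real (exp (- (norm x)\<^sup>2 / K\<^sup>2)) * cis (- (x \<bullet> v)))) =
      (K\<^sup>2 / 2) powr (DIM('a) / 2) * (LINT \<xi>|lborel. exp (- (K\<^sup>2 / 4) * (norm (\<xi> - v))\<^sup>2) * Re (w \<xi>))"
proof -
  let ?g = "\<lambda>\<xi>. exp (- (K\<^sup>2 / 4) * (norm (\<xi> - v))\<^sup>2)"
  have 1: "Re (complex_of_real (?g \<xi>) * w \<xi>) = ?g \<xi> * Re (w \<xi>)" for \<xi>
    by (rule Re_complex_of_real_mult)
  note p = gaussian_modulated_pairing[OF f K, of v]
  show "integrable lborel (\<lambda>\<xi>. ?g \<xi> * Re (w \<xi>))"
    using integrable_Re[OF p(1)] unfolding 1 .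
  show "Re (LINT x|lborel. f x * (complex_of_real (exp (- (norm x)\<^sup>2 / K\<^sup>2)) * cis (- (x \<bullet> v)))) =
      (K\<^sup>2 / 2) powr (DIM('a) / 2) * (LINT \<xi>|lborel. ?g \<xi> * Re (w \<xi>))"
    unfolding p(3) Re_complex_of_real_mult integral_Re[OF p(1), symmetric] 1 ..
qed

text \<open>The averaging kernel in frequency is a positive Gaussian, so the sign of
  \<open>Re (w \<xi>)\<close> survives for every centre v.\<close>

lemma gaussian_modulated_pairing_nonneg:
  fixes f w :: "'a::euclidean_space \<Rightarrow> complex"
  assumes "f has_fourier_transform w" "0 < K" "AE \<xi> in lborel. 0 \<le> Re (w \<xi>)"
  shows "0 \<le> Re (LINT x|lborel. f x * (complex_of_real (exp (- (norm x)\<^sup>2 / K\<^sup>2)) * cis (- (x \<bullet> v))))"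
  unfolding gaussian_modulated_pairing_Re(2)[OF assms(1,2)]
  using assms(3) by (intro mult_nonneg_nonneg integral_nonneg_AE) auto

lemma content_annulus:
  assumes "0 < \<rho>"
  shows "measure lborel (ball (0::'a::euclidean_space) \<rho> - cball 0 (\<rho> / 2)) =
    unit_ball_vol DIM('a) * (1 - 1 / 2 ^ DIM('a)) * \<rho> ^ DIM('a)"
proof -
  have "cball (0::'a) (\<rho> / 2) \<subseteq> ball 0 \<rho>" using assms by auto
  then have "measure lborel (ball (0::'a) \<rho> - cball 0 (\<rho> / 2)) =
      measure lborel (ball (0::'a) \<rho>) - measure lborel (cball (0::'a) (\<rho> / 2))"
    using emeasure_bounded_finite[OF bounded_ball, of "0::'a" \<rho>] by (intro measure_Diff) auto
  then show ?thesis
    using assms by (simp add: content_ball content_cball power_divide algebra_simps)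
qed

text \<open>Only the annulus at distance between 1/(2K) and 1/K from a is used: the frequency
  Gaussian is at least exp (-1/4) there, the singularity at least c K^(n/2) / ln (2K) with n the
  dimension, and the volume of order K^(-n) cancels the prefactor of order K^n. Elsewhere the
  integrand is dropped by positivity.\<close>

lemma gaussian_modulated_pairing_lower_bound:
  fixes f w :: "'a::euclidean_space \<Rightarrow> complex"
  assumes f: "f has_fourier_transform w" and pos: "AE \<xi> in lborel. 0 \<le> Re (w \<xi>)"
    and c: "0 < c"
    and low: "AE \<xi> in lborel. \<xi> \<in> ball 0 r \<longrightarrow>
      c * norm \<xi> powr (- real DIM('a) / 2) * inverse (ln (inverse (norm \<xi>))) \<le> Re (w (\<xi> + a))"
  obtains c' where "0 < c'" "\<And>K. 1 < K \<Longrightarrow> 1 / K < r \<Longrightarrow>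
    c' * K powr (DIM('a) / 2) / ln (2 * K) \<le>
      Re (LINT x|lborel. f x * (complex_of_real (exp (- (norm x)\<^sup>2 / K\<^sup>2)) * cis (- (x \<bullet> a))))"
proof
  define V where "V = unit_ball_vol DIM('a) * (1 - 1 / 2 ^ DIM('a))"
  have V: "V > 0"
    unfolding V_def by (intro mult_pos_pos) (auto simp: unit_ball_vol_pos field_simps)
  \<comment> \<open>The factors come, in this order, from the prefactor of the pairing, the Gaussian
    on the annulus, the hypothesis \<open>low\<close> and the volume of the annulus.\<close>
  define c' where "c' = (1 / 2) powr (DIM('a) / 2) * exp (- (1 / 4)) * c * V"
  show "c' > 0" using c V by (simp add: c'_def)
  fix K :: real assume K: "1 < K" "1 / K < r"
  define A where "A = ball (0::'a) (1 / K) - cball 0 (1 / K / 2)"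
  define m where "m = exp (- (1 / 4)) * (c * K powr (DIM('a) / 2) / ln (2 * K))"
  let ?g = "\<lambda>\<xi>. exp (- (K\<^sup>2 / 4) * (norm (\<xi> - a))\<^sup>2) * Re (w \<xi>)"
  have int: "integrable lborel ?g" by (rule gaussian_modulated_pairing_Re(1)[OF f]) (use K in auto)
  have intA: "integrable lborel (\<lambda>\<xi>. indicator A \<xi> * m)"
    unfolding A_def
    by (intro integrable_mult_left integrable_real_indicator emeasure_bounded_finite bounded_diff bounded_ball) auto
  \<comment> \<open>Translation by a centres the annulus at 0; integrability, integral and
    positivity are transported along it.\<close>
  have distr: "lborel = distr lborel borel ((+) a)" by (rule lborel_distr_plus[symmetric])
  have g_meas: "?g \<in> borel_measurable borel" using int by auto
  have int': "integrable lborel (\<lambda>\<xi>. ?g (a + \<xi>))"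
    using int by (subst (asm) distr, subst (asm) integrable_distr_eq) (use g_meas in auto)
  have eq: "(LINT \<xi>|lborel. ?g \<xi>) = (LINT \<xi>|lborel. ?g (a + \<xi>))"
    by (subst distr, subst integral_distr) (use g_meas in auto)
  have pos': "AE \<xi> in lborel. 0 \<le> Re (w (a + \<xi>))"
  proof -
    have "AE \<xi> in distr lborel borel ((+) a). 0 \<le> Re (w \<xi>)"
      using pos by (subst lborel_distr_plus)
    from AE_distrD[OF _ this] show ?thesis by auto
  qed
  have "AE \<xi> in lborel. indicator A \<xi> * m \<le> ?g (a + \<xi>)"
    using low pos'
  proof eventually_elim
    case (elim \<xi>)
    show ?case
    proof (cases "\<xi> \<in> A")
      case True
      then have \<xi>: "norm \<xi> < 1 / K" "1 / K / 2 < norm \<xi>" by (auto simp: A_def)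
      then have \<xi>0: "norm \<xi> > 0" using K by (auto intro: le_less_trans[rotated])
      have "K powr (DIM('a) / 2) \<le> norm \<xi> powr (- real DIM('a) / 2)"
      proof -
        have "K \<le> inverse (norm \<xi>)" using \<xi> \<xi>0 K by (simp add: field_simps)
        then have "K powr (DIM('a) / 2) \<le> inverse (norm \<xi>) powr (DIM('a) / 2)"
          using K by (intro powr_mono2) auto
        then show ?thesis using \<xi>0 by (simp add: powr_minus inverse_powr)
      qed
      \<comment> \<open>The outer radius gives norm \<xi> < 1/K < 1, so the logarithm is positive
        and the inequality can be inverted; the inner radius gives the upper bound 2K for its
        argument.\<close>
      moreover have "inverse (ln (2 * K)) \<le> inverse (ln (inverse (norm \<xi>)))"
      proof (rule le_imp_inverse_le)
        have *: "1 < inverse (norm \<xi>)" "inverse (norm \<xi>) \<le> 2 * K"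
          using \<xi> \<xi>0 K less_trans[OF \<xi>(1), of 1] by (auto simp: field_simps)
        show "ln (inverse (norm \<xi>)) \<le> ln (2 * K)" using * \<xi>0 K by (subst ln_le_cancel_iff) auto
        show "0 < ln (inverse (norm \<xi>))" using *(1) by (rule ln_gt_zero)
      qed
      ultimately have "c * K powr (DIM('a) / 2) * inverse (ln (2 * K)) \<le>
          c * norm \<xi> powr (- real DIM('a) / 2) * inverse (ln (inverse (norm \<xi>)))"
        using c K by (intro mult_mono) auto
      also have "\<dots> \<le> Re (w (a + \<xi>))" using elim(1) \<xi> K by (auto simp: add.commute)
      finally have w: "c * K powr (DIM('a) / 2) / ln (2 * K) \<le> Re (w (a + \<xi>))" by (simp add: field_simps)
      have "K * norm \<xi> \<le> 1" using \<xi> K by (simp add: field_simps)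
      then have "(K * norm \<xi>)\<^sup>2 \<le> 1" using K by (intro power_le_one) auto
      then have "exp (- (1 / 4)) \<le> exp (- (K\<^sup>2 / 4) * (norm \<xi>)\<^sup>2)" by (simp add: power_mult_distrib)
      then have "m \<le> exp (- (K\<^sup>2 / 4) * (norm \<xi>)\<^sup>2) * Re (w (a + \<xi>))"
        unfolding m_def using w c K by (intro mult_mono) auto
      then show ?thesis using True by simp
    qed (use elim in auto)
  qed
  from integral_mono_AE[OF intA int' this]
  have "measure lborel A * m \<le> (LINT \<xi>|lborel. ?g \<xi>)"
    unfolding eq by (simp add: A_def)
  then have "(K\<^sup>2 / 2) powr (DIM('a) / 2) * (measure lborel A * m) \<le> (K\<^sup>2 / 2) powr (DIM('a) / 2) * (LINT \<xi>|lborel. ?g \<xi>)"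
    by (intro mult_left_mono) auto
  moreover have "(K\<^sup>2 / 2) powr (DIM('a) / 2) * (measure lborel A * m) = c' * K powr (DIM('a) / 2) / ln (2 * K)"
  proof -
    have "(K\<^sup>2 / 2) powr (DIM('a) / 2) = (1 / 2) powr (DIM('a) / 2) * K ^ DIM('a)"
    proof -
      have "(K\<^sup>2) powr (DIM('a) / 2) = K ^ DIM('a)"
      proof -
        have "(K\<^sup>2) powr (DIM('a) / 2) = (K powr 2) powr (DIM('a) / 2)" using K by simp
        also have "\<dots> = K powr real DIM('a)" unfolding powr_powr by simp
        also have "\<dots> = K ^ DIM('a)" using K by (intro powr_realpow) auto
        finally show ?thesis .
      qed
      then show ?thesis using powr_mult[of "K\<^sup>2" "1 / 2" "DIM('a) / 2"] by (simp add: mult.commute)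
    qed
    moreover have "measure lborel A = V * (1 / K) ^ DIM('a)"
      unfolding A_def V_def using K by (subst content_annulus) auto
    moreover have "K ^ DIM('a) * (1 / K) ^ DIM('a) = 1"
      using K by (simp flip: power_mult_distrib)
    moreover have "x * k * (V * k' * m) = x * V * m * (k * k')" for x k k' by (simp only: mult_ac)
    ultimately have "(K\<^sup>2 / 2) powr (DIM('a) / 2) * (measure lborel A * m) = (1 / 2) powr (DIM('a) / 2) * V * m"
      by (simp only: mult_1_right)
    then show ?thesis unfolding m_def c'_def by (simp only: times_divide_eq_right mult_ac)
  qed
  ultimately show "c' * K powr (DIM('a) / 2) / ln (2 * K) \<le>
      Re (LINT x|lborel. f x * (complex_of_real (exp (- (norm x)\<^sup>2 / K\<^sup>2)) * cis (- (x \<bullet> a))))"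
    using gaussian_modulated_pairing_Re(2)[OF f, of K a] K by simp
qed

section \<open>Test functions\<close>

text \<open>The formal adjoint of the damped wave operator, as it falls on test functions:
  integration by parts has flipped the sign of the first time derivative.\<close>

definition damped_wave :: "(real \<times> 'a::euclidean_space \<Rightarrow> real) \<Rightarrow> real \<times> 'a \<Rightarrow> real" where
  "damped_wave \<psi> z = time_deriv (time_deriv \<psi>) z - time_deriv \<psi> z - space_laplacian \<psi> z"

text \<open>The radial factor is a function of x \<bullet> x, not of norm x, which avoids any
  singularity at the origin. All derivatives reduce to those of three functions of one real
  variable.\<close>

definition sep :: "'a::euclidean_space \<Rightarrow> (real \<Rightarrow> real) \<Rightarrow> (real \<Rightarrow> real) \<Rightarrow> (real \<Rightarrow> real) \<Rightarrow> real \<times> 'a \<Rightarrow> real" where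
  "sep a E G q z = E (fst z) * (G (snd z \<bullet> snd z) * q (a \<bullet> snd z))"

text \<open>The derivative is again a combination of \<open>sep\<close> terms, so the rule can be
  applied repeatedly.\<close>

lemma sep_has_derivative:
  assumes E: "\<And>y. (E has_real_derivative E1 y) (at y)"
    and G: "\<And>y. (G has_real_derivative G1 y) (at y)"
    and q: "\<And>y. (q has_real_derivative q1 y) (at y)"
  shows "(sep a E G q has_derivative (\<lambda>v. fst v * sep a E1 G q z
    + (2 * (snd z \<bullet> snd v) * sep a E G1 q z + (a \<bullet> snd v) * sep a E G q1 z))) (at z)"
proof -
  note D = has_derivative_compose[OF _ E[unfolded has_field_derivative_def]]
    has_derivative_compose[OF _ G[unfolded has_field_derivative_def]]
    has_derivative_compose[OF _ q[unfolded has_field_derivative_def]]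
  show ?thesis
    unfolding sep_def
    by (auto intro!: derivative_eq_intros D simp: algebra_simps inner_commute)
qed

lemma damped_wave_sep:
  fixes a :: "'a::euclidean_space"
  assumes E: "\<And>y. (E has_real_derivative E1 y) (at y)" "\<And>y. (E1 has_real_derivative E2 y) (at y)"
    and G: "\<And>y. (G has_real_derivative G1 y) (at y)" "\<And>y. (G1 has_real_derivative G2 y) (at y)"
    and q: "\<And>y. (q has_real_derivative q1 y) (at y)" "\<And>y. (q1 has_real_derivative q2 y) (at y)"
  shows "time_deriv (sep a E G q) = sep a E1 G q"
    and "damped_wave (sep a E G q) z = sep a E2 G q z - sep a E1 G q z
      - (2 * real DIM('a) * sep a E G1 q z + 4 * (snd z \<bullet> snd z) * sep a E G2 q z
        + 4 * (a \<bullet> snd z) * sep a E G1 q1 z + (a \<bullet> a) * sep a E G q2 z)"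
proof -
  have time: "time_deriv (sep a F G q) = sep a F' G q" if "\<And>y. (F has_real_derivative F' y) (at y)" for F F'
    unfolding time_deriv_def dir_deriv_eqI[OF sep_has_derivative[OF that G(1) q(1)]] by simp
  show "time_deriv (sep a E G q) = sep a E1 G q" by (rule time[OF E(1)])
  have space: "dir_deriv (0, b) (dir_deriv (0, b) (sep a E G q)) z =
      2 * (b \<bullet> b) * sep a E G1 q z + 4 * ((snd z \<bullet> b) * (snd z \<bullet> b)) * sep a E G2 q z
      + 4 * ((a \<bullet> b) * (snd z \<bullet> b)) * sep a E G1 q1 z + ((a \<bullet> b) * (a \<bullet> b)) * sep a E G q2 z" for b
  proof -
    have 1: "dir_deriv (0, b) (sep a E G q) =
        (\<lambda>z. 2 * (snd z \<bullet> b) * sep a E G1 q z + (a \<bullet> b) * sep a E G q1 z)"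
      unfolding dir_deriv_eqI[OF sep_has_derivative[OF E(1) G(1) q(1)]] by simp
    have 2: "((\<lambda>z. 2 * (snd z \<bullet> b) * sep a E G1 q z + (a \<bullet> b) * sep a E G q1 z) has_derivative
      (\<lambda>v. 2 * (snd z \<bullet> b) * (fst v * sep a E1 G1 q z
          + (2 * (snd z \<bullet> snd v) * sep a E G2 q z + (a \<bullet> snd v) * sep a E G1 q1 z))
        + 2 * (snd v \<bullet> b) * sep a E G1 q z
        + (a \<bullet> b) * (fst v * sep a E1 G q1 z
          + (2 * (snd z \<bullet> snd v) * sep a E G1 q1 z + (a \<bullet> snd v) * sep a E G q2 z)))) (at z)"
      by (intro has_derivative_add has_derivative_mult has_derivative_mult_right
          sep_has_derivative E G q has_derivative_inner_left has_derivative_snd has_derivative_ident)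
    show ?thesis unfolding 1 dir_deriv_eq[OF 2] by (simp add: algebra_simps)
  qed
  \<comment> \<open>The coordinate sums recombine into inner products, and the sum of b \<bullet> b
    over \<open>Basis\<close> yields the dimension.\<close>
  have "space_laplacian (sep a E G q) z = 2 * real DIM('a) * sep a E G1 q z + 4 * (snd z \<bullet> snd z) * sep a E G2 q z
        + 4 * (a \<bullet> snd z) * sep a E G1 q1 z + (a \<bullet> a) * sep a E G q2 z"
    unfolding space_laplacian_def space
    unfolding sum.distrib sum_distrib_right[symmetric] sum_distrib_left[symmetric] euclidean_inner[symmetric]
    by (simp add: inner_Basis)
  then show "damped_wave (sep a E G q) z = sep a E2 G q z - sep a E1 G q z
      - (2 * real DIM('a) * sep a E G1 q z + 4 * (snd z \<bullet> snd z) * sep a E G2 q z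
        + 4 * (a \<bullet> snd z) * sep a E G1 q1 z + (a \<bullet> a) * sep a E G q2 z)"
    unfolding damped_wave_def time[OF E(1)] time[OF E(2)] by simp
qed

text \<open>The cutoff depends on \<open>t\<^sup>2\<close>, so its derivative vanishes at \<open>t = 0\<close> and the term with \<open>u0\<close> alone
  drops out of the weak formulation.\<close>

definition time_cutoff :: "real \<Rightarrow> real \<Rightarrow> real" where
  "time_cutoff \<tau> t = bump 0 (1 - t\<^sup>2 / \<tau>\<^sup>2)"

definition time_cutoff1 :: "real \<Rightarrow> real \<Rightarrow> real" where
  "time_cutoff1 \<tau> t = - (2 * t / \<tau>\<^sup>2) * bump 2 (1 - t\<^sup>2 / \<tau>\<^sup>2)"

definition time_cutoff2 :: "real \<Rightarrow> real \<Rightarrow> real" where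
  "time_cutoff2 \<tau> t = (2 * t / \<tau>\<^sup>2)\<^sup>2 * (bump 4 (1 - t\<^sup>2 / \<tau>\<^sup>2) - 2 * bump 3 (1 - t\<^sup>2 / \<tau>\<^sup>2))
    - 2 / \<tau>\<^sup>2 * bump 2 (1 - t\<^sup>2 / \<tau>\<^sup>2)"

text \<open>The argument y stands for x \<bullet> x, hence the squares of the lengths N and
  K.\<close>

definition profile :: "real \<Rightarrow> real \<Rightarrow> real \<Rightarrow> real" where
  "profile N K y = bump 0 (1 - y / N\<^sup>2) * exp (- y / K\<^sup>2)"

definition profile1 :: "real \<Rightarrow> real \<Rightarrow> real \<Rightarrow> real" where
  "profile1 N K y = - (bump 2 (1 - y / N\<^sup>2) / N\<^sup>2 + bump 0 (1 - y / N\<^sup>2) / K\<^sup>2) * exp (- y / K\<^sup>2)"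

definition profile2 :: "real \<Rightarrow> real \<Rightarrow> real \<Rightarrow> real" where
  "profile2 N K y = ((bump 4 (1 - y / N\<^sup>2) - 2 * bump 3 (1 - y / N\<^sup>2)) / N\<^sup>2 / N\<^sup>2
    + 2 * bump 2 (1 - y / N\<^sup>2) / N\<^sup>2 / K\<^sup>2 + bump 0 (1 - y / N\<^sup>2) / K\<^sup>2 / K\<^sup>2) * exp (- y / K\<^sup>2)"

lemma bump_compose_deriv:
  assumes "(h has_real_derivative h') (at t)"
  shows "((\<lambda>t. bump 0 (h t)) has_real_derivative bump 2 (h t) * h') (at t)"
    and "((\<lambda>t. bump 2 (h t)) has_real_derivative (bump 4 (h t) - 2 * bump 3 (h t)) * h') (at t)"
  using DERIV_chain2[OF bump_has_real_derivative assms, of 0]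
    DERIV_chain2[OF bump_has_real_derivative assms, of 2]
  by (simp_all add: eval_nat_numeral)

lemma time_cutoff_deriv:
  "(time_cutoff \<tau> has_real_derivative time_cutoff1 \<tau> t) (at t)"
  "(time_cutoff1 \<tau> has_real_derivative time_cutoff2 \<tau> t) (at t)"
proof -
  have h: "((\<lambda>t. 1 - t\<^sup>2 / \<tau>\<^sup>2) has_real_derivative - (2 * t / \<tau>\<^sup>2)) (at t)"
  proof -
    \<comment> \<open>Written with \<open>inverse\<close>, the derivative rules need no side
      condition on \<tau>; at \<tau> = 0 both sides agree by \<open>inverse 0 = 0\<close>.\<close>
    have "((\<lambda>t. 1 - t\<^sup>2 * inverse (\<tau>\<^sup>2)) has_real_derivative - (2 * t * inverse (\<tau>\<^sup>2))) (at t)"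
      by (auto intro!: derivative_eq_intros)
    then show ?thesis by (simp only: divide_inverse)
  qed
  show "(time_cutoff \<tau> has_real_derivative time_cutoff1 \<tau> t) (at t)"
    using bump_compose_deriv(1)[OF h] unfolding time_cutoff_def time_cutoff1_def
    by (simp only: mult.commute)
  have l: "((\<lambda>t. - (2 * t / \<tau>\<^sup>2)) has_real_derivative - (2 / \<tau>\<^sup>2)) (at t)"
    using DERIV_minus[OF DERIV_cdivide[OF DERIV_cmult_Id[of 2]], of "\<tau>\<^sup>2"] by simp
  show "(time_cutoff1 \<tau> has_real_derivative time_cutoff2 \<tau> t) (at t)"
    unfolding time_cutoff1_def time_cutoff2_def
  proof (rule DERIV_cong[OF DERIV_mult[OF l bump_compose_deriv(2)[OF h]]])
    have "- d * b + (e * - c) * - c = c\<^sup>2 * e - d * b" for b c d e :: real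
      by (simp add: power2_eq_square)
    then show "- (2 / \<tau>\<^sup>2) * bump 2 (1 - t\<^sup>2 / \<tau>\<^sup>2)
        + (bump 4 (1 - t\<^sup>2 / \<tau>\<^sup>2) - 2 * bump 3 (1 - t\<^sup>2 / \<tau>\<^sup>2)) * - (2 * t / \<tau>\<^sup>2) * - (2 * t / \<tau>\<^sup>2)
      = (2 * t / \<tau>\<^sup>2)\<^sup>2 * (bump 4 (1 - t\<^sup>2 / \<tau>\<^sup>2) - 2 * bump 3 (1 - t\<^sup>2 / \<tau>\<^sup>2))
        - 2 / \<tau>\<^sup>2 * bump 2 (1 - t\<^sup>2 / \<tau>\<^sup>2)" .
  qed
qed

lemma profile_deriv:
  "(profile N K has_real_derivative profile1 N K y) (at y)"
  "(profile1 N K has_real_derivative profile2 N K y) (at y)"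
proof -
  have h: "((\<lambda>y. 1 - y / N\<^sup>2) has_real_derivative - (1 / N\<^sup>2)) (at y)"
    using DERIV_cdivide[OF DERIV_ident, of "N\<^sup>2"] DERIV_diff[OF DERIV_const] by force
  have e: "((\<lambda>y. exp (- y / K\<^sup>2)) has_real_derivative - (1 / K\<^sup>2) * exp (- y / K\<^sup>2)) (at y)"
  proof -
    have "((\<lambda>y. exp (c * y)) has_real_derivative c * exp (c * y)) (at y)" for c
      by (auto intro!: derivative_eq_intros)
    from this[of "- (1 / K\<^sup>2)"] show ?thesis by simp
  qed
  have b: "((\<lambda>y. bump 0 (1 - y / N\<^sup>2)) has_real_derivative - (bump 2 (1 - y / N\<^sup>2) / N\<^sup>2)) (at y)"
    "((\<lambda>y. bump 2 (1 - y / N\<^sup>2)) has_real_derivative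
      - ((bump 4 (1 - y / N\<^sup>2) - 2 * bump 3 (1 - y / N\<^sup>2)) / N\<^sup>2)) (at y)"
    using bump_compose_deriv[OF h] by simp_all
  show "(profile N K has_real_derivative profile1 N K y) (at y)"
    using DERIV_mult[OF b(1) e] unfolding profile_def profile1_def by (simp add: algebra_simps)
  have "((\<lambda>y. - (bump 2 (1 - y / N\<^sup>2) / N\<^sup>2 + bump 0 (1 - y / N\<^sup>2) / K\<^sup>2)) has_real_derivative
      - (- ((bump 4 (1 - y / N\<^sup>2) - 2 * bump 3 (1 - y / N\<^sup>2)) / N\<^sup>2) / N\<^sup>2 + - (bump 2 (1 - y / N\<^sup>2) / N\<^sup>2) / K\<^sup>2)) (at y)"
    by (rule DERIV_minus[OF DERIV_add[OF DERIV_cdivide[OF b(2)] DERIV_cdivide[OF b(1)]]])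
  from DERIV_mult[OF this e]
  show "(profile1 N K has_real_derivative profile2 N K y) (at y)"
    unfolding profile1_def profile2_def by (simp add: algebra_simps add_divide_distrib diff_divide_distrib)
qed

text \<open>The factor \<open>1 + cos y\<close> is non-negative and mixes the characters of
  frequencies 0, a and -a with positive weights. For a = 0 it is the constant 2, so one family
  contains both the oscillating function and the non-oscillating weight.\<close>

definition test_fn :: "'a::euclidean_space \<Rightarrow> real \<Rightarrow> real \<Rightarrow> real \<Rightarrow> real \<times> 'a \<Rightarrow> real" where
  "test_fn a \<tau> N K = sep a (time_cutoff \<tau>) (profile N K) (\<lambda>y. 1 + cos y)"

lemma one_plus_cos_deriv:
  "((\<lambda>y::real. 1 + cos y) has_real_derivative - sin y) (at y)"
  "((\<lambda>y::real. - sin y) has_real_derivative - cos y) (at y)"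
  by (auto intro!: derivative_eq_intros)

lemmas damped_wave_test_fn = damped_wave_sep(2)[OF time_cutoff_deriv profile_deriv one_plus_cos_deriv,
    folded test_fn_def]

lemmas time_deriv_test_fn = damped_wave_sep(1)[OF time_cutoff_deriv profile_deriv one_plus_cos_deriv,
    folded test_fn_def]

lemma test_fn_nonneg: "0 \<le> test_fn a \<tau> N K z"
proof -
  have "0 \<le> 1 + cos y" for y :: real using cos_ge_minus_one[of y] by linarith
  then show ?thesis by (simp add: test_fn_def sep_def time_cutoff_def profile_def bump_nonneg)
qed

lemma time_cutoff_nonneg: "0 \<le> time_cutoff \<tau> t" and profile_nonneg: "0 \<le> profile N K y"
  by (simp_all add: time_cutoff_def profile_def bump_nonneg)

text \<open>Negative times have to be excluded: the time cutoff is even in t and does not vanish for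
  -\<tau> < t < 0.\<close>

lemma test_fn_zero:
  assumes "0 < \<tau>" "0 < N" "0 \<le> fst z" "z \<notin> {0..\<tau>} \<times> cball 0 N"
  shows "test_fn a \<tau> N K z = 0"
proof -
  consider "\<tau> < fst z" | "N < norm (snd z)"
    using assms by (cases z) (auto simp: not_le)
  then show ?thesis
  proof cases
    case 1
    then have "1 \<le> (fst z)\<^sup>2 / \<tau>\<^sup>2" using assms by (simp add: power_mono)
    then show ?thesis by (simp add: test_fn_def sep_def time_cutoff_def bump_nonpos)
  next
    case 2
    then have "1 \<le> (snd z \<bullet> snd z) / N\<^sup>2" using assms by (simp add: power_mono flip: power2_norm_eq_inner)
    then show ?thesis by (simp add: test_fn_def sep_def profile_def bump_nonpos)
  qed
qed

lemma smooth_test_fn: "smooth (test_fn a \<tau> N K :: real \<times> 'a::euclidean_space \<Rightarrow> real)"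
proof -
  have 1: "smooth (\<lambda>z::real \<times> 'a. 1 - (fst z)\<^sup>2 / \<tau>\<^sup>2)"
  proof -
    have "smooth (\<lambda>z::real \<times> 'a. 1 + (- 1 / \<tau>\<^sup>2) * (fst z * fst z))"
      by (intro smooth_add smooth_mult smooth_const smooth_linear bounded_linear_fst)
    then show ?thesis by (simp add: power2_eq_square)
  qed
  have i: "smooth (\<lambda>z::real \<times> 'a. snd z \<bullet> snd z)"
  proof -
    have "smooth (\<lambda>z::real \<times> 'a. \<Sum>b\<in>Basis. (snd z \<bullet> b) * (snd z \<bullet> b))"
      by (intro smooth_sum smooth_mult smooth_linear bounded_linear_inner_left_comp bounded_linear_snd)
    then show ?thesis by (subst euclidean_inner)
  qed
  have 2: "smooth (\<lambda>z::real \<times> 'a. 1 + c * (snd z \<bullet> snd z))" and 3: "smooth (\<lambda>z::real \<times> 'a. c * (snd z \<bullet> snd z))" for c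
    by (intro smooth_add smooth_mult smooth_const i)+
  have "smooth (\<lambda>z::real \<times> 'a. bump 0 (1 - (fst z)\<^sup>2 / \<tau>\<^sup>2) *
    (bump 0 (1 + (- 1 / N\<^sup>2) * (snd z \<bullet> snd z)) * exp ((- 1 / K\<^sup>2) * (snd z \<bullet> snd z)) * (1 + cos (a \<bullet> snd z))))"
    by (intro smooth_mult smooth_bump smooth_exp smooth_add smooth_const smooth_cos 1 2 3 smooth_linear
        bounded_linear_inner_right_comp bounded_linear_snd)
  moreover have "test_fn a \<tau> N K = (\<lambda>z::real \<times> 'a. bump 0 (1 - (fst z)\<^sup>2 / \<tau>\<^sup>2) *
    (bump 0 (1 + (- 1 / N\<^sup>2) * (snd z \<bullet> snd z)) * exp ((- 1 / K\<^sup>2) * (snd z \<bullet> snd z)) * (1 + cos (a \<bullet> snd z))))"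
    by (simp add: fun_eq_iff test_fn_def sep_def time_cutoff_def profile_def)
  ultimately show ?thesis by simp
qed

lemma test_fn_in_test_functions:
  assumes "0 < \<tau>" "ereal \<tau> < T" "0 < N"
  shows "test_fn a \<tau> N K \<in> test_functions T"
proof -
  have "compact ({0..\<tau>} \<times> cball (0::'a) N)" by (intro compact_Times compact_cball) auto
  moreover have "{0..\<tau>} \<times> cball (0::'a) N \<subseteq> strip T"
    using assms(2) by (auto simp: strip_def intro: le_less_trans[rotated])
  moreover have "test_fn a \<tau> N K z = 0" if "z \<in> strip T - {0..\<tau>} \<times> cball (0::'a) N" for z
    using test_fn_zero[OF assms(1,3), of z] that by (auto simp: strip_def)
  ultimately show ?thesis unfolding test_functions_def using smooth_test_fn by blast
qed

section \<open>Pointwise bounds for the adjoint operator on the test functions\<close>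

text \<open>Where the cutoff is positive, 2t/\<tau>^2 is at most 2/\<tau> in absolute value, and
  \<tau> \<ge> 1 turns the quadratic terms into multiples of 1/\<tau> as well. The constant 16
  collects 4 * 3 and 2 from the second derivative and 2 from the first.\<close>

lemma time_cutoff_bounds:
  assumes C: "\<And>m x. m \<in> {0,2,3,4} \<Longrightarrow> bump m x \<le> C * bump 0 x powr \<theta>" "0 < C" and \<tau>: "1 \<le> \<tau>"
  shows "time_cutoff \<tau> t \<le> C * time_cutoff \<tau> t powr \<theta>"
    and "\<bar>time_cutoff2 \<tau> t - time_cutoff1 \<tau> t\<bar> \<le> 16 * C / \<tau> * time_cutoff \<tau> t powr \<theta>"
proof -
  define y where "y = 1 - t\<^sup>2 / \<tau>\<^sup>2"
  define S where "S = bump 0 y powr \<theta>"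
  have E: "time_cutoff \<tau> t = bump 0 y" by (simp add: time_cutoff_def y_def)
  show "time_cutoff \<tau> t \<le> C * time_cutoff \<tau> t powr \<theta>" unfolding E by (rule C) simp
  show "\<bar>time_cutoff2 \<tau> t - time_cutoff1 \<tau> t\<bar> \<le> 16 * C / \<tau> * time_cutoff \<tau> t powr \<theta>"
  proof (cases "y \<le> 0")
    case True
    then show ?thesis
      by (simp add: time_cutoff2_def time_cutoff1_def E y_def[symmetric] bump_nonpos)
  next
    case False
    then have "t\<^sup>2 \<le> \<tau>\<^sup>2" using \<tau> by (simp add: y_def field_simps)
    then have "\<bar>t\<bar> \<le> \<tau>" using \<tau> abs_le_square_iff[of t \<tau>] by simp
    then have t: "\<bar>2 * t / \<tau>\<^sup>2\<bar> \<le> 2 / \<tau>" using \<tau> by (simp add: abs_mult field_simps power2_eq_square)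
    have \<tau>2: "2 / \<tau>\<^sup>2 \<le> 2 / \<tau>" using \<tau> by (simp add: field_simps power2_eq_square)
    have CS: "C * S \<ge> 0" using C(2) by (simp add: S_def)
    have b: "0 \<le> bump m y" "m \<in> {0,2,3,4} \<Longrightarrow> bump m y \<le> C * S" for m
      using C(1)[of m y] by (auto simp: bump_nonneg S_def)
    have "(2 * t / \<tau>\<^sup>2)\<^sup>2 \<le> (2 / \<tau>)\<^sup>2" using t by (intro power2_le_iff_abs_le[THEN iffD2]) (use \<tau> in auto)
    also have "\<dots> \<le> 4 / \<tau>" using \<tau> by (simp add: field_simps power2_eq_square)
    finally have t2: "(2 * t / \<tau>\<^sup>2)\<^sup>2 \<le> 4 / \<tau>" .
    have "\<bar>bump 4 y - 2 * bump 3 y\<bar> \<le> 3 * (C * S)"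
      using b(1)[of 4] b(1)[of 3] b(2)[of 4] b(2)[of 3] by (auto simp: abs_le_iff)
    then have "\<bar>(2 * t / \<tau>\<^sup>2)\<^sup>2 * (bump 4 y - 2 * bump 3 y)\<bar> \<le> 4 / \<tau> * (3 * (C * S))"
      unfolding abs_mult using t2 \<tau> by (intro mult_mono) auto
    moreover have "\<bar>2 / \<tau>\<^sup>2 * bump 2 y\<bar> \<le> 2 / \<tau> * (C * S)"
      unfolding abs_mult using \<tau>2 b[of 2] \<tau> by (intro mult_mono) auto
    moreover have "\<bar>2 * t / \<tau>\<^sup>2 * bump 2 y\<bar> \<le> 2 / \<tau> * (C * S)"
      unfolding abs_mult using t b[of 2] \<tau> by (intro mult_mono) auto
    ultimately have "\<bar>time_cutoff2 \<tau> t - time_cutoff1 \<tau> t\<bar>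
        \<le> 4 / \<tau> * (3 * (C * S)) + 2 / \<tau> * (C * S) + 2 / \<tau> * (C * S)"
      unfolding time_cutoff2_def time_cutoff1_def y_def[symmetric] by linarith
    also have "\<dots> = 16 * C / \<tau> * S" by (simp add: field_simps)
    finally show ?thesis by (simp add: E S_def)
  qed
qed

text \<open>Each derivative in y costs 1/K^2, because N \<ge> K lets 1/N^2 be replaced by 1/K^2;
  this makes the constants uniform in N. Only the bump in \<open>S\<close> is raised to the power
  \<theta>: the Gaussian stays whole, so that part of it can be spent later.\<close>

lemma profile_bounds:
  fixes y :: real
  assumes C: "\<And>m x. m \<in> {0,2,3,4} \<Longrightarrow> bump m x \<le> C * bump 0 x powr \<theta>" "0 < C"
    and K: "0 < K" "K \<le> N"
  defines "S \<equiv> bump 0 (1 - y / N\<^sup>2) powr \<theta> * exp (- y / K\<^sup>2)"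
  shows "\<bar>profile N K y\<bar> \<le> C * S" "\<bar>profile1 N K y\<bar> \<le> 2 * C / K\<^sup>2 * S" "\<bar>profile2 N K y\<bar> \<le> 6 * C / K\<^sup>2 / K\<^sup>2 * S"
proof -
  define B where "B = C * bump 0 (1 - y / N\<^sup>2) powr \<theta>"
  have B: "0 \<le> B" using C(2) by (simp add: B_def)
  have b: "0 \<le> bump m (1 - y / N\<^sup>2)" "m \<in> {0,2,3,4} \<Longrightarrow> bump m (1 - y / N\<^sup>2) \<le> B" for m
    using C(1)[of m "1 - y / N\<^sup>2"] by (auto simp: bump_nonneg B_def)
  have KN: "K\<^sup>2 \<le> N\<^sup>2" "0 < K\<^sup>2" "0 < N\<^sup>2" using K by (auto intro: power_mono)
  have d: "\<bar>x / N\<^sup>2\<bar> \<le> D / K\<^sup>2" if "\<bar>x\<bar> \<le> D" for x D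
  proof -
    have "\<bar>x / N\<^sup>2\<bar> = \<bar>x\<bar> / N\<^sup>2" by simp
    also have "\<dots> \<le> D / K\<^sup>2" using that KN by (intro frac_le) auto
    finally show ?thesis .
  qed
  have d': "\<bar>x / K\<^sup>2\<bar> \<le> D / K\<^sup>2" if "\<bar>x\<bar> \<le> D" for x D
    using that KN by (simp add: abs_divide divide_right_mono)
  have 0: "\<bar>bump 0 (1 - y / N\<^sup>2)\<bar> \<le> B" and 2: "\<bar>bump 2 (1 - y / N\<^sup>2)\<bar> \<le> B" "\<bar>2 * bump 2 (1 - y / N\<^sup>2)\<bar> \<le> 2 * B"
    using b[of 0] b[of 2] by auto
  have 3: "\<bar>bump 4 (1 - y / N\<^sup>2) - 2 * bump 3 (1 - y / N\<^sup>2)\<bar> \<le> 3 * B"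
    using b(1)[of 4] b(1)[of 3] b(2)[of 4] b(2)[of 3] by (auto simp: abs_le_iff)
  have S: "S * C = B * exp (- y / K\<^sup>2)" by (simp add: S_def B_def)
  have *: "\<bar>x * exp (- y / K\<^sup>2)\<bar> \<le> k * S" if "\<bar>x\<bar> \<le> k / C * B" for x k
  proof -
    have "\<bar>x * exp (- y / K\<^sup>2)\<bar> \<le> k / C * B * exp (- y / K\<^sup>2)"
      unfolding abs_mult abs_exp_cancel using that by (rule mult_right_mono) simp
    also have "\<dots> = k * S" using S C(2) by (simp add: field_simps)
    finally show ?thesis .
  qed
  show "\<bar>profile N K y\<bar> \<le> C * S"
    unfolding profile_def using 0 C(2) by (intro *) auto
  show "\<bar>profile1 N K y\<bar> \<le> 2 * C / K\<^sup>2 * S"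
    unfolding profile1_def
  proof (rule *)
    have "\<bar>- (bump 2 (1 - y / N\<^sup>2) / N\<^sup>2 + bump 0 (1 - y / N\<^sup>2) / K\<^sup>2)\<bar> \<le> B / K\<^sup>2 + B / K\<^sup>2"
      using d[OF 2(1)] d'[OF 0] by linarith
    also have "\<dots> = 2 * C / K\<^sup>2 / C * B" using C(2) by simp
    finally show "\<bar>- (bump 2 (1 - y / N\<^sup>2) / N\<^sup>2 + bump 0 (1 - y / N\<^sup>2) / K\<^sup>2)\<bar> \<le> 2 * C / K\<^sup>2 / C * B" .
  qed
  show "\<bar>profile2 N K y\<bar> \<le> 6 * C / K\<^sup>2 / K\<^sup>2 * S"
    unfolding profile2_def
  proof (rule *)
    have "\<bar>(bump 4 (1 - y / N\<^sup>2) - 2 * bump 3 (1 - y / N\<^sup>2)) / N\<^sup>2 / N\<^sup>2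
      + 2 * bump 2 (1 - y / N\<^sup>2) / N\<^sup>2 / K\<^sup>2 + bump 0 (1 - y / N\<^sup>2) / K\<^sup>2 / K\<^sup>2\<bar>
      \<le> 3 * B / K\<^sup>2 / K\<^sup>2 + 2 * B / K\<^sup>2 / K\<^sup>2 + B / K\<^sup>2 / K\<^sup>2"
      by (intro order_trans[OF abs_triangle_ineq] add_mono d[OF d[OF 3]] d'[OF d[OF 2(2)]] d'[OF d'[OF 0]])
    also have "\<dots> = 6 * C / K\<^sup>2 / K\<^sup>2 / C * B" using C(2) by simp
    finally show "\<bar>(bump 4 (1 - y / N\<^sup>2) - 2 * bump 3 (1 - y / N\<^sup>2)) / N\<^sup>2 / N\<^sup>2
      + 2 * bump 2 (1 - y / N\<^sup>2) / N\<^sup>2 / K\<^sup>2 + bump 0 (1 - y / N\<^sup>2) / K\<^sup>2 / K\<^sup>2\<bar> \<le> 6 * C / K\<^sup>2 / K\<^sup>2 / C * B" .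
  qed
qed

text \<open>The summands of the bracket come from the time derivatives, the Laplacian of the
  profile, the mixed term of profile and oscillation, and the Laplacian of the oscillation. The last
  one decays neither in \<tau> nor in K, which is why the oscillating function is later used with
  duration 1.\<close>

lemma damped_wave_test_fn_bound:
  assumes \<theta>: "0 < \<theta>" "\<theta> < 1"
  obtains B where "0 < B" "\<And>(a::'a::euclidean_space) \<tau> N K z. 1 \<le> \<tau> \<Longrightarrow> 1 \<le> K \<Longrightarrow> K \<le> N \<Longrightarrow>
    \<bar>damped_wave (test_fn a \<tau> N K) z\<bar> \<le> B * (1 / \<tau> + 1 / K\<^sup>2 + norm a / K + (norm a)\<^sup>2) *
      (time_cutoff \<tau> (fst z) powr \<theta> * (profile N K (snd z \<bullet> snd z) powr \<theta>
        * exp (- ((1 - \<theta>) / 2) * (norm (snd z))\<^sup>2 / K\<^sup>2)))"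
proof -
  obtain C0 where C0: "\<And>m. 0 < C0 m" "\<And>m x. bump m x \<le> C0 m * bump 0 x powr \<theta>"
  proof -
    have "\<exists>C. 0 < C \<and> (\<forall>x. bump m x \<le> C * bump 0 x powr \<theta>)" for m
      by (rule bump_le_powr[OF \<theta>(2), of m]) blast
    then show ?thesis using that by metis
  qed
  define C where "C = C0 0 + C0 2 + C0 3 + C0 4"
  have C: "0 < C" using C0(1) by (auto simp: C_def intro: add_pos_pos)
  have Cb: "bump m x \<le> C * bump 0 x powr \<theta>" if "m \<in> {0,2,3,4}" for m x
  proof -
    have "C0 m \<le> C" using that C0(1)[of 0] C0(1)[of 2] C0(1)[of 3] C0(1)[of 4] by (auto simp: C_def)
    then have "C0 m * bump 0 x powr \<theta> \<le> C * bump 0 x powr \<theta>" by (intro mult_right_mono) auto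
    then show ?thesis using C0(2)[of m x] by linarith
  qed
  obtain M where M: "0 < M" "\<And>y. 0 \<le> y \<Longrightarrow> (1 + y) ^ 1 * exp (- ((1 - \<theta>) / 2) * y) \<le> M"
    using power_exp_bounded[of "(1 - \<theta>) / 2" 1] \<theta> by auto
  define n where "n = real DIM('a)"
  have n: "n \<ge> 1" using DIM_positive[where 'a = 'a] by (simp add: n_def Suc_le_eq)
  \<comment> \<open>\<open>8 * n + 48\<close> is the largest of the coefficients 32, 8n + 48, 8 and
    1 that the summands of the bracket receive below.\<close>
  define B where "B = C\<^sup>2 * M * (8 * n + 48)"
  have "0 < B" using C M n by (simp add: B_def)
  moreover have "\<bar>damped_wave (test_fn a \<tau> N K) z\<bar> \<le> B * (1 / \<tau> + 1 / K\<^sup>2 + norm a / K + (norm a)\<^sup>2) *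
      (time_cutoff \<tau> (fst z) powr \<theta> * (profile N K (snd z \<bullet> snd z) powr \<theta>
        * exp (- ((1 - \<theta>) / 2) * (norm (snd z))\<^sup>2 / K\<^sup>2)))"
    if \<tau>: "1 \<le> \<tau>" and K: "1 \<le> K" "K \<le> N" for a :: 'a and \<tau> N K z
  proof -
    define t x where "t = fst z" and "x = snd z"
    define \<sigma> where "\<sigma> = (x \<bullet> x) / K\<^sup>2"
    define S where "S = bump 0 (1 - (x \<bullet> x) / N\<^sup>2) powr \<theta> * exp (- (x \<bullet> x) / K\<^sup>2)"
    define E where "E = time_cutoff \<tau> t powr \<theta>"
    define A where "A = norm a"
    have nonneg: "0 \<le> \<sigma>" "0 \<le> S" "0 \<le> E" "0 \<le> A" by (auto simp: \<sigma>_def S_def E_def A_def)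
    have K0: "0 < K" "0 < K\<^sup>2" using K by auto
    note time = time_cutoff_bounds[OF Cb C \<tau>, of t, folded E_def]
    note prof = profile_bounds[OF Cb C K0(1) K(2), of "x \<bullet> x", folded S_def]
    have cE: "\<bar>time_cutoff \<tau> t\<bar> \<le> C * E" using time(1) by (simp add: time_cutoff_nonneg)
    have q: "\<bar>1 + cos (a \<bullet> x)\<bar> \<le> 2" "\<bar>- sin (a \<bullet> x)\<bar> \<le> 1" "\<bar>- cos (a \<bullet> x)\<bar> \<le> 1"
      using cos_ge_minus_one[of "a \<bullet> x"] cos_le_one[of "a \<bullet> x"] abs_sin_le_one[of "a \<bullet> x"] by linarith+
    \<comment> \<open>Since \<sigma> \<le> (1 + \<sigma>)^2, the mixed term also grows at most like
      1 + \<sigma>, so a single such factor covers all five terms.\<close>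
    have xK: "norm x \<le> K * (1 + \<sigma>)"
    proof -
      have "(norm x)\<^sup>2 = K\<^sup>2 * \<sigma>" using K0 by (simp add: \<sigma>_def power2_norm_eq_inner)
      also have "\<dots> \<le> K\<^sup>2 * (1 + \<sigma>)\<^sup>2" using nonneg by (intro mult_left_mono) (auto simp: power2_eq_square algebra_simps)
      finally have "(norm x)\<^sup>2 \<le> (K * (1 + \<sigma>))\<^sup>2" by (simp add: power_mult_distrib)
      then show ?thesis by (rule power2_le_imp_le) (use K0 nonneg in auto)
    qed
    have ax: "\<bar>4 * (a \<bullet> x)\<bar> \<le> 4 * (A * (K * (1 + \<sigma>)))"
      using Cauchy_Schwarz_ineq2[of a x] mult_left_mono[OF xK, of A] nonneg by (simp add: A_def)
    have xx: "x \<bullet> x = \<sigma> * K\<^sup>2" using K0 by (simp add: \<sigma>_def)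
    define c0 where "c0 = C\<^sup>2 * (E * (S * (1 + \<sigma>)))"
    have c0: "0 \<le> c0" using nonneg by (simp add: c0_def)
    have T1: "\<bar>(time_cutoff2 \<tau> t - time_cutoff1 \<tau> t) * (profile N K (x \<bullet> x) * (1 + cos (a \<bullet> x)))\<bar> \<le> 32 * (1 / \<tau>) * c0"
    proof -
      have "\<bar>(time_cutoff2 \<tau> t - time_cutoff1 \<tau> t) * (profile N K (x \<bullet> x) * (1 + cos (a \<bullet> x)))\<bar>
          \<le> (16 * C / \<tau> * E) * (C * S * 2)"
        unfolding abs_mult using time(2) prof(1) q(1) C \<tau> nonneg by (intro mult_mono) auto
      also have "\<dots> = 32 * (1 / \<tau>) * (C\<^sup>2 * (E * (S * 1)))" by (simp add: power2_eq_square)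
      also have "\<dots> \<le> 32 * (1 / \<tau>) * c0"
        unfolding c0_def using nonneg \<tau> by (intro mult_left_mono) auto
      finally show ?thesis .
    qed
    have T2: "\<bar>2 * n * (time_cutoff \<tau> t * (profile1 N K (x \<bullet> x) * (1 + cos (a \<bullet> x))))\<bar> \<le> 8 * n * (1 / K\<^sup>2) * c0"
    proof -
      have "\<bar>2 * n * (time_cutoff \<tau> t * (profile1 N K (x \<bullet> x) * (1 + cos (a \<bullet> x))))\<bar>
          \<le> 2 * n * (C * E * (2 * C / K\<^sup>2 * S * 2))"
        unfolding abs_mult using cE prof(2) q(1) C n nonneg by (intro mult_mono) auto
      also have "\<dots> = 8 * n * (1 / K\<^sup>2) * (C\<^sup>2 * (E * (S * 1)))" by (simp add: power2_eq_square)
      also have "\<dots> \<le> 8 * n * (1 / K\<^sup>2) * c0"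
        unfolding c0_def using nonneg n by (intro mult_left_mono) auto
      finally show ?thesis .
    qed
    have T3: "\<bar>4 * (x \<bullet> x) * (time_cutoff \<tau> t * (profile2 N K (x \<bullet> x) * (1 + cos (a \<bullet> x))))\<bar> \<le> 48 * (1 / K\<^sup>2) * c0"
    proof -
      have "\<bar>4 * (x \<bullet> x) * (time_cutoff \<tau> t * (profile2 N K (x \<bullet> x) * (1 + cos (a \<bullet> x))))\<bar>
          \<le> 4 * (\<sigma> * K\<^sup>2) * (C * E * (6 * C / K\<^sup>2 / K\<^sup>2 * S * 2))"
        unfolding abs_mult using cE prof(3) q(1) C nonneg xx by (intro mult_mono) auto
      also have "\<dots> = 48 * (1 / K\<^sup>2) * (C\<^sup>2 * (E * (S * \<sigma>)))" using K0 by (simp add: power2_eq_square)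
      also have "\<dots> \<le> 48 * (1 / K\<^sup>2) * c0"
        unfolding c0_def using nonneg by (intro mult_left_mono) auto
      finally show ?thesis .
    qed
    have T4: "\<bar>4 * (a \<bullet> x) * (time_cutoff \<tau> t * (profile1 N K (x \<bullet> x) * - sin (a \<bullet> x)))\<bar> \<le> 8 * (A / K) * c0"
    proof -
      have "\<bar>4 * (a \<bullet> x) * (time_cutoff \<tau> t * (profile1 N K (x \<bullet> x) * - sin (a \<bullet> x)))\<bar>
          \<le> 4 * (A * (K * (1 + \<sigma>))) * (C * E * (2 * C / K\<^sup>2 * S * 1))"
        unfolding abs_mult[of "4 * (a \<bullet> x)"] abs_mult[of "time_cutoff \<tau> t"] abs_mult[of "profile1 N K (x \<bullet> x)"]
        using ax cE prof(2) q(2) C nonneg K0 by (intro mult_mono) auto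
      also have "\<dots> = 8 * (A / K) * c0" using K0 by (simp add: c0_def power2_eq_square)
      finally show ?thesis .
    qed
    have T5: "\<bar>(a \<bullet> a) * (time_cutoff \<tau> t * (profile N K (x \<bullet> x) * - cos (a \<bullet> x)))\<bar> \<le> A\<^sup>2 * c0"
    proof -
      have "\<bar>(a \<bullet> a) * (time_cutoff \<tau> t * (profile N K (x \<bullet> x) * - cos (a \<bullet> x)))\<bar>
          \<le> A\<^sup>2 * (C * E * (C * S * 1))"
        unfolding abs_mult[of "a \<bullet> a"] abs_mult[of "time_cutoff \<tau> t"] abs_mult[of "profile N K (x \<bullet> x)"]
        using cE prof(1) q(3) C nonneg K0 by (intro mult_mono) (auto simp: A_def power2_norm_eq_inner)
      also have "\<dots> = A\<^sup>2 * (C\<^sup>2 * (E * (S * 1)))" by (simp add: power2_eq_square)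
      also have "\<dots> \<le> A\<^sup>2 * c0"
        unfolding c0_def using nonneg by (intro mult_left_mono) auto
      finally show ?thesis .
    qed
    have "damped_wave (test_fn a \<tau> N K) z =
        (time_cutoff2 \<tau> t - time_cutoff1 \<tau> t) * (profile N K (x \<bullet> x) * (1 + cos (a \<bullet> x)))
        - (2 * n * (time_cutoff \<tau> t * (profile1 N K (x \<bullet> x) * (1 + cos (a \<bullet> x))))
          + 4 * (x \<bullet> x) * (time_cutoff \<tau> t * (profile2 N K (x \<bullet> x) * (1 + cos (a \<bullet> x))))
          + 4 * (a \<bullet> x) * (time_cutoff \<tau> t * (profile1 N K (x \<bullet> x) * - sin (a \<bullet> x)))
          + (a \<bullet> a) * (time_cutoff \<tau> t * (profile N K (x \<bullet> x) * - cos (a \<bullet> x))))"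
      unfolding damped_wave_test_fn sep_def t_def[symmetric] x_def[symmetric] n_def[symmetric]
      by (simp only: left_diff_distrib)
    then have "\<bar>damped_wave (test_fn a \<tau> N K) z\<bar> \<le> 32 * (1 / \<tau>) * c0 + 8 * n * (1 / K\<^sup>2) * c0 + 48 * (1 / K\<^sup>2) * c0
        + 8 * (A / K) * c0 + A\<^sup>2 * c0"
      using T1 T2 T3 T4 T5 by linarith
    also have "\<dots> = (32 * (1 / \<tau>) + (8 * n + 48) * (1 / K\<^sup>2) + 8 * (A / K) + 1 * A\<^sup>2) * c0"
      by (simp only: distrib_right) 
    also have "\<dots> \<le> ((8 * n + 48) * (1 / \<tau>) + (8 * n + 48) * (1 / K\<^sup>2) + (8 * n + 48) * (A / K) + (8 * n + 48) * A\<^sup>2) * c0"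
      using c0 n nonneg \<tau> K by (intro mult_right_mono add_mono) auto
    also have "\<dots> = C\<^sup>2 * (8 * n + 48) * (1 / \<tau> + 1 / K\<^sup>2 + A / K + A\<^sup>2) * (E * (S * (1 + \<sigma>)))"
      by (simp only: c0_def distrib_left mult_ac)
    also have "\<dots> \<le> C\<^sup>2 * (8 * n + 48) * (1 / \<tau> + 1 / K\<^sup>2 + A / K + A\<^sup>2) *
        (E * (M * (profile N K (x \<bullet> x) powr \<theta> * exp (- ((1 - \<theta>) / 2) * \<sigma>))))"
    proof -
      \<comment> \<open>exp (-\<sigma>) is split three ways: exp (-\<theta> \<sigma>) completes the
        power of \<open>profile\<close>, one half of the remainder absorbs 1 + \<sigma> through
        \<open>M\<close>, and the other half is left to make the bound integrable in x.\<close>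
      have "S = profile N K (x \<bullet> x) powr \<theta> * exp (- (1 - \<theta>) * \<sigma>)"
        unfolding S_def profile_def \<sigma>_def
        by (subst powr_mult) (auto simp: bump_nonneg powr_def[of "exp _"] algebra_simps diff_divide_distrib simp flip: exp_add)
      also have "exp (- (1 - \<theta>) * \<sigma>) = exp (- ((1 - \<theta>) / 2) * \<sigma>) * exp (- ((1 - \<theta>) / 2) * \<sigma>)"
        unfolding exp_add[symmetric] by (rule arg_cong[of _ _ exp]) (simp add: field_simps)
      finally have "S * (1 + \<sigma>) = profile N K (x \<bullet> x) powr \<theta> * exp (- ((1 - \<theta>) / 2) * \<sigma>) * ((1 + \<sigma>) ^ 1 * exp (- ((1 - \<theta>) / 2) * \<sigma>))"
        by (simp only: mult_ac power_one_right)
      also have "\<dots> \<le> profile N K (x \<bullet> x) powr \<theta> * exp (- ((1 - \<theta>) / 2) * \<sigma>) * M"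
        using M(2)[OF nonneg(1)] by (intro mult_left_mono) auto
      finally have "S * (1 + \<sigma>) \<le> M * (profile N K (x \<bullet> x) powr \<theta> * exp (- ((1 - \<theta>) / 2) * \<sigma>))"
        by (simp only: mult_ac)
      then show ?thesis
        using nonneg n \<tau> K by (intro mult_left_mono) (auto intro!: mult_nonneg_nonneg add_nonneg_nonneg)
    qed
    also have "\<dots> = B * (1 / \<tau> + 1 / K\<^sup>2 + A / K + A\<^sup>2) *
        (E * (profile N K (x \<bullet> x) powr \<theta> * exp (- ((1 - \<theta>) / 2) * \<sigma>)))"
      by (simp only: B_def mult_ac)
    finally show ?thesis
      by (simp add: A_def E_def t_def x_def \<sigma>_def power2_norm_eq_inner)
  qed
  ultimately show ?thesis using that by blast
qed

section \<open>Estimates for weak solutions\<close>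

lemma strip_borel: "strip T \<in> sets (borel :: (real \<times> 'a::euclidean_space) measure)"
proof -
  have "closed {z :: real \<times> 'a. 0 \<le> fst z}" "open {z :: real \<times> 'a. ereal (fst z) < T}"
    by (intro closed_Collect_le open_Collect_less continuous_intros continuous_on_ereal)+
  then show ?thesis
    unfolding strip_def Collect_conj_eq by (intro sets.Int borel_closed borel_open)
qed

lemma continuous_test_fn: "continuous_on UNIV (test_fn a \<tau> N K)"
  using smooth_test_fn[of a \<tau> N K] C_k.simps(1) unfolding smooth_def by blast

text \<open>The test function is bounded on the compact set \<open>Q\<close> and vanishes on the
  rest of the strip, so local integrability of u suffices.\<close>

lemma Lp_loc_test_fn_integrable:
  fixes a :: "'a::euclidean_space"
  assumes u: "u \<in> Lp_loc_on p (strip T)" and \<tau>: "0 < \<tau>" "ereal \<tau> < T" "0 < N"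
  shows "set_integrable lborel (strip T) (\<lambda>z. norm (u z) powr p * test_fn a \<tau> N K z)"
proof -
  define Q where "Q = {0..\<tau>} \<times> cball (0::'a) N"
  have Q: "compact Q" unfolding Q_def by (intro compact_Times compact_cball) auto
  have QT: "Q \<subseteq> strip T" using \<tau>(2) by (auto simp: Q_def strip_def intro: le_less_trans[rotated])
  have uQ: "integrable lborel (\<lambda>z. indicator Q z *\<^sub>R norm (u z) powr p)"
    using u Q QT by (auto simp: Lp_loc_on_def set_integrable_def)
  obtain M where M: "\<And>z. z \<in> Q \<Longrightarrow> norm (test_fn a \<tau> N K z) \<le> M"
    using compact_continuous_image[OF continuous_on_subset[OF continuous_test_fn subset_UNIV] Q, THEN compact_imp_bounded]
    unfolding bounded_iff by blast
  have "test_fn a \<tau> N K \<in> borel_measurable borel"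
    by (intro borel_measurable_continuous_onI continuous_test_fn)
  then have meas: "(\<lambda>z. (indicator Q z *\<^sub>R norm (u z) powr p) * test_fn a \<tau> N K z) \<in> borel_measurable lborel"
    using borel_measurable_integrable[OF uQ] by (intro borel_measurable_times) auto
  have "integrable lborel (\<lambda>z. (indicator Q z *\<^sub>R norm (u z) powr p) * test_fn a \<tau> N K z)"
  proof (rule Bochner_Integration.integrable_bound[OF integrable_mult_left[OF uQ, of M] meas])
    show "AE z in lborel. norm ((indicator Q z *\<^sub>R norm (u z) powr p) * test_fn a \<tau> N K z)
      \<le> norm ((indicator Q z *\<^sub>R norm (u z) powr p) * M)"
    proof (rule AE_I2)
      fix z show "norm ((indicator Q z *\<^sub>R norm (u z) powr p) * test_fn a \<tau> N K z)
        \<le> norm ((indicator Q z *\<^sub>R norm (u z) powr p) * M)"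
        using M[of z] by (cases "z \<in> Q") (auto simp: abs_mult intro!: mult_left_mono)
    qed
  qed
  moreover have "indicator (strip T) z *\<^sub>R (norm (u z) powr p * test_fn a \<tau> N K z)
      = (indicator Q z *\<^sub>R norm (u z) powr p) * test_fn a \<tau> N K z" for z
    using QT test_fn_zero[OF \<tau>(1,3), of z a K] by (auto simp: indicator_def strip_def Q_def)
  ultimately show ?thesis unfolding set_integrable_def by presburger
qed

lemma space_time_gaussian_integral:
  assumes "0 < \<alpha>" "0 \<le> \<tau>"
  shows "has_bochner_integral lborel (\<lambda>z::real \<times> 'a::euclidean_space. indicator {0..\<tau>} (fst z) * exp (- \<alpha> * (norm (snd z))\<^sup>2))
    (\<tau> * (pi / \<alpha>) powr (DIM('a) / 2))"
proof -
  have I: "integrable lborel (\<lambda>t. indicat_real {0..\<tau>} t)" "(LINT t|lborel. indicat_real {0..\<tau>} t) = \<tau>"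
    using assms by auto
  have G: "integrable lborel (\<lambda>x::'a. exp (- \<alpha> * (norm x)\<^sup>2))"
    "(LINT x::'a|lborel. exp (- \<alpha> * (norm x)\<^sup>2)) = (pi / \<alpha>) powr (DIM('a) / 2)"
    using integral_gaussian[OF assms(1), where 'a = 'a] by (auto simp: has_bochner_integral_iff)
  let ?H = "\<lambda>(t, x::'a). indicat_real {0..\<tau>} t * exp (- \<alpha> * (norm x)\<^sup>2)"
  have "integrable (lborel \<Otimes>\<^sub>M lborel) ?H"
  proof (rule lborel_pair.Fubini_integrable)
    show "?H \<in> borel_measurable (lborel \<Otimes>\<^sub>M lborel)" by measurable
    show "integrable lborel (\<lambda>t. LINT x|lborel. norm (?H (t, x)))"
      using I by (simp add: abs_mult)
    show "AE t in lborel. integrable lborel (\<lambda>x. ?H (t, x))" using G(1) by auto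
  qed
  moreover from lborel_pair.integral_fst[OF this]
  have "integral\<^sup>L (lborel \<Otimes>\<^sub>M lborel) ?H = \<tau> * (pi / \<alpha>) powr (DIM('a) / 2)"
    using G I by simp
  ultimately show ?thesis
    by (simp add: has_bochner_integral_iff lborel_prod split_beta')
qed

lemma conjugate_exponent_gt_1:
  fixes p p' :: real
  assumes "1 < p" "1 / p + 1 / p' = 1"
  shows "1 < p'" "p' / p = p' - 1"
proof -
  have "1 / p < 1" "0 < 1 / p" using assms(1) by auto
  then have *: "0 < 1 / p'" "1 / p' < 1" using assms(2) by linarith+
  then show p': "1 < p'" by (simp add: field_simps split: if_splits)
  have "p' * (1 / p + 1 / p') = p'" using assms(2) by simp
  then show "p' / p = p' - 1" using p' by (simp add: distrib_left)
qed

text \<open>Young's inequality for the factors U (\<mu> W)^(1/p) and \<mu>^(-1/p) b, with the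
  coefficients 1/p and 1/p' bounded by 1. A small \<mu> permits absorption; a large \<mu> makes the
  remainder small, as 1 - p' is negative.\<close>

lemma weighted_Young:
  fixes p p' :: real
  assumes p: "1 < p" "1 / p + 1 / p' = 1" and nonneg: "0 \<le> U" "0 \<le> W" "0 \<le> b" "0 < \<mu>"
  shows "U * (b * W powr (1 / p)) \<le> \<mu> * (U powr p * W) + \<mu> powr (1 - p') * b powr p'"
proof -
  note p' = conjugate_exponent_gt_1[OF p]
  define x y where "x = U * (\<mu> * W) powr (1 / p)" and "y = \<mu> powr (- 1 / p) * b"
  have xy: "0 \<le> x" "0 \<le> y" using nonneg by (auto simp: x_def y_def)
  have "\<mu> powr (1 / p) * \<mu> powr (- 1 / p) = 1"
    using nonneg by (simp flip: powr_add)
  then have "U * (b * W powr (1 / p)) = x * y"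
    using nonneg by (simp add: x_def y_def powr_mult mult_ac)
  also have "\<dots> \<le> x powr p / p + y powr p' / p'"
    using p p' xy by (intro Youngs_inequality) auto
  also have "\<dots> \<le> x powr p + y powr p'"
    using p p' by (intro add_mono) (auto simp: divide_le_eq mult_le_cancel_left1)
  also have "x powr p = \<mu> * (U powr p * W)"
    unfolding x_def using nonneg p by (subst powr_mult) (auto simp: powr_powr)
  also have "y powr p' = \<mu> powr (1 - p') * b powr p'"
  proof -
    have "- 1 / p * p' = 1 - p'" using p' by simp
    then show ?thesis unfolding y_def using nonneg by (subst powr_mult) (auto simp: powr_powr)
  qed
  finally show ?thesis .
qed

text \<open>The weight need not belong to the test function: the oscillating test function with \<open>a\<close> is
  later compared with the weight for \<open>a' = 0\<close>.\<close>

lemma weak_solution_test_estimate: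
  fixes a a' :: "'a::euclidean_space" and u0 u1 :: "'a \<Rightarrow> complex"
  assumes sol: "weak_solution p T \<epsilon> u0 u1 u"
    and p: "1 < p" "1 / p + 1 / p' = 1"
    and \<tau>: "0 < \<tau>" "ereal \<tau> < T" "0 < \<tau>'" "ereal \<tau>' < T" "0 < N"
    and bound: "\<And>z. 0 \<le> fst z \<Longrightarrow> \<bar>damped_wave (test_fn a \<tau> N K) z\<bar> \<le>
      B * indicator {0..\<tau>} (fst z) * (test_fn a' \<tau>' N K z powr (1 / p) * exp (- \<kappa> * (norm (snd z))\<^sup>2))"
    and pos: "0 < \<kappa>" "0 \<le> B" "0 < \<mu>"
  shows "(LINT z:strip T|lborel. norm (u z) powr p * test_fn a \<tau> N K z)
      + \<epsilon> * Re (LINT x|lborel. test_fn a \<tau> N K (0, x) *\<^sub>R (u0 x + u1 x))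
    \<le> \<mu> * (LINT z:strip T|lborel. norm (u z) powr p * test_fn a' \<tau>' N K z)
      + \<mu> powr (1 - p') * B powr p' * (\<tau> * (pi / (p' * \<kappa>)) powr (DIM('a) / 2))"
proof -
  note p' = conjugate_exponent_gt_1[OF p]
  define L where "L = damped_wave (test_fn a \<tau> N K)"
  define W where "W = test_fn a' \<tau>' N K"
  define c where "c = \<mu> powr (1 - p') * B powr p'"
  define H where "H z = indicat_real {0..\<tau>} (fst z) * exp (- (p' * \<kappa>) * (norm (snd z))\<^sup>2)" for z :: "real \<times> 'a"
  \<comment> \<open>The pointwise majorant supplied by \<open>weighted_Young\<close>: the weighted
    power of u plus a Gaussian remainder whose exponential has been raised to the power p'.\<close>
  define D where "D z = \<mu> * (norm (u z) powr p * W z) + c * H z" for z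
  have u: "u \<in> Lp_loc_on p (strip T)" using sol by (simp add: weak_solution_def)
  have W0: "0 \<le> W z" for z by (simp add: W_def test_fn_nonneg)
  have c0: "0 \<le> c" by (simp add: c_def)
  have H0: "0 \<le> H z" for z by (simp add: H_def)
  have D0: "0 \<le> D z" for z using W0 c0 H0 pos by (auto simp: D_def intro!: add_nonneg_nonneg mult_nonneg_nonneg)
  have H: "integrable lborel H" "integral\<^sup>L lborel H = \<tau> * (pi / (p' * \<kappa>)) powr (DIM('a) / 2)"
    using space_time_gaussian_integral[of "p' * \<kappa>" \<tau>, where 'a = 'a] pos p' \<tau>
    unfolding H_def by (auto simp: has_bochner_integral_iff)
  have Hs: "set_integrable lborel (strip T) H"
    unfolding set_integrable_def using H(1) strip_borel by (intro integrable_mult_indicator) auto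
  have Ws: "set_integrable lborel (strip T) (\<lambda>z. norm (u z) powr p * W z)"
    unfolding W_def by (rule Lp_loc_test_fn_integrable[OF u \<tau>(3-5)])
  have Ds: "set_integrable lborel (strip T) D"
    unfolding D_def by (intro set_integral_add set_integrable_mult_right Hs Ws)
  have pw: "norm (L z *\<^sub>R u z) \<le> D z" if "z \<in> strip T" for z
  proof -
    have "0 \<le> fst z" using that by (simp add: strip_def)
    note b = bound[OF this, folded L_def W_def]
    define e where "e = exp (- \<kappa> * (norm (snd z))\<^sup>2)"
    show ?thesis
    proof (cases "fst z \<in> {0..\<tau>}")
      case True
      then have "norm (L z *\<^sub>R u z) \<le> norm (u z) * ((B * e) * W z powr (1 / p))"
        using b mult_left_mono[OF b, of "norm (u z)"] by (simp add: e_def mult_ac)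
      also have "\<dots> \<le> \<mu> * (norm (u z) powr p * W z) + \<mu> powr (1 - p') * (B * e) powr p'"
        using p W0 pos by (intro weighted_Young) (auto simp: e_def)
      also have "(B * e) powr p' = B powr p' * H z"
        using True pos by (simp add: powr_mult H_def e_def powr_def[of "exp _"] mult_ac)
      finally show ?thesis by (simp add: D_def c_def mult_ac)
    next
      case False
      then show ?thesis using b D0[of z] by simp
    qed
  qed
  have "norm (LINT z:strip T|lborel. L z *\<^sub>R u z) \<le> (LINT z:strip T|lborel. D z)"
  proof (cases "set_integrable lborel (strip T) (\<lambda>z. L z *\<^sub>R u z)")
    case True
    show ?thesis
      unfolding set_lebesgue_integral_def
    proof (rule Bochner_Integration.integral_norm_bound_integral)
      fix z show "norm (indicat_real (strip T) z *\<^sub>R L z *\<^sub>R u z) \<le> indicat_real (strip T) z *\<^sub>R D z"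
        using pw[of z] by (cases "z \<in> strip T") auto
    qed (use True Ds in \<open>auto simp: set_integrable_def\<close>)
  next
    \<comment> \<open>The Bochner integral of a non-integrable function is 0 by convention, so the
      bound still holds because \<open>D\<close> is non-negative.\<close>
    case False
    then have "(LINT z:strip T|lborel. L z *\<^sub>R u z) = 0"
      unfolding set_lebesgue_integral_def set_integrable_def by (rule not_integrable_integral_eq)
    moreover have "0 \<le> (LINT z:strip T|lborel. D z)"
      unfolding set_lebesgue_integral_def using D0 by (intro integral_nonneg_AE) auto
    ultimately show ?thesis by simp
  qed
  also have "\<dots> = \<mu> * (LINT z:strip T|lborel. norm (u z) powr p * W z) + c * (LINT z:strip T|lborel. H z)"
    unfolding D_def using Ws Hs by (subst set_integral_add) auto
  also have "(LINT z:strip T|lborel. H z) \<le> integral\<^sup>L lborel H"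
    unfolding set_lebesgue_integral_def
    using H(1) Hs H0 by (intro integral_mono) (auto simp: set_integrable_def indicator_def)
  finally have main: "norm (LINT z:strip T|lborel. L z *\<^sub>R u z) \<le>
      \<mu> * (LINT z:strip T|lborel. norm (u z) powr p * W z) + c * integral\<^sup>L lborel H"
    using c0 by (simp add: mult_left_mono)
  have "time_deriv (test_fn a \<tau> N K) (0, x) = 0" for x
    unfolding time_deriv_test_fn by (simp add: sep_def time_cutoff1_def)
  then have "complex_of_real (LINT z:strip T|lborel. norm (u z) powr p * test_fn a \<tau> N K z)
        + \<epsilon> *\<^sub>R (LINT x|lborel. test_fn a \<tau> N K (0, x) *\<^sub>R (u0 x + u1 x))
        = (LINT z:strip T|lborel. L z *\<^sub>R u z)"
    using sol test_fn_in_test_functions[OF \<tau>(1,2,5), of a K]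
    by (auto simp: weak_solution_def L_def damped_wave_def)
  \<comment> \<open>The solution and the data may be complex-valued; the estimate compares real
    parts only.\<close>
  from arg_cong[OF this, of Re]
  have "(LINT z:strip T|lborel. norm (u z) powr p * test_fn a \<tau> N K z)
      + \<epsilon> * Re (LINT x|lborel. test_fn a \<tau> N K (0, x) *\<^sub>R (u0 x + u1 x))
      \<le> norm (LINT z:strip T|lborel. L z *\<^sub>R u z)"
    using complex_Re_le_cmod[of "LINT z:strip T|lborel. L z *\<^sub>R u z"] by simp
  also note main
  finally show ?thesis unfolding H(2) W_def c_def .
qed

section \<open>Removing the spatial cutoff, and the sign of the data terms\<close>

lemma bump_0_le_1: "bump 0 x \<le> 1"
  by (simp add: bump_def)

lemma test_fn_at_0: "test_fn a \<tau> N K (0, x) =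
    bump 0 1 * (bump 0 (1 - (norm x)\<^sup>2 / N\<^sup>2) * (exp (- (norm x)\<^sup>2 / K\<^sup>2) * (1 + cos (a \<bullet> x))))"
  by (simp add: test_fn_def sep_def time_cutoff_def profile_def power2_norm_eq_inner mult_ac)

lemma one_plus_cos_bounds: "0 \<le> 1 + cos (y::real)" "1 + cos y \<le> 2"
  using cos_ge_minus_one[of y] cos_le_one[of y] by linarith+

text \<open>Dominated convergence as the cutoff radius m grows. The value \<open>bump 0 1\<close>
  enters twice: as the time cutoff at t = 0 and as the limit of the spatial cutoff.\<close>

lemma test_fn_pairing_tendsto:
  fixes f :: "'a::euclidean_space \<Rightarrow> complex"
  assumes f: "f \<in> L2_space" and K: "0 < K"
  shows "(\<lambda>m. Re (LINT x|lborel. test_fn a \<tau> (real m) K (0, x) *\<^sub>R f x)) \<longlonglongrightarrow>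
    (bump 0 1)\<^sup>2 * Re (LINT x|lborel. f x * (complex_of_real (exp (- (norm x)\<^sup>2 / K\<^sup>2) * (1 + cos (a \<bullet> x)))))"
proof -
  define G where "G x = exp (- (norm x)\<^sup>2 / K\<^sup>2) * (1 + cos (a \<bullet> x))" for x :: 'a
  define b where "b = bump 0 1"
  have b: "0 \<le> b" "b \<le> 1" by (simp_all add: b_def bump_nonneg bump_0_le_1)
  have [measurable]: "f \<in> borel_measurable borel" by (rule L2_spaceD(1)[OF f])
  have G_meas: "G \<in> borel_measurable borel"
    unfolding G_def by (intro borel_measurable_continuous_onI continuous_intros) (use K in auto)
  have lim: "(\<lambda>m. LINT x|lborel. test_fn a \<tau> (real m) K (0, x) *\<^sub>R f x) \<longlonglongrightarrow> (LINT x|lborel. (b * (b * G x)) *\<^sub>R f x)"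
  proof (rule integral_dominated_convergence[where w = "\<lambda>x. 2 * norm (f x * complex_of_real (exp (- (norm x)\<^sup>2 / K\<^sup>2)))"])
    show "(\<lambda>x. (b * (b * G x)) *\<^sub>R f x) \<in> borel_measurable lborel"
      using G_meas by simp
    have "(\<lambda>x. test_fn a \<tau> (real m) K (0, x)) \<in> borel_measurable borel" for m
      by (intro borel_measurable_continuous_onI continuous_on_compose2[OF continuous_test_fn] continuous_intros) auto
    then show "(\<lambda>x. test_fn a \<tau> (real m) K (0, x) *\<^sub>R f x) \<in> borel_measurable lborel" for m
      by simp
    show "integrable lborel (\<lambda>x. 2 * norm (f x * complex_of_real (exp (- (norm x)\<^sup>2 / K\<^sup>2))))"
      using integrable_L2_mult_gaussian[OF f K] by (intro integrable_mult_right integrable_norm)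
    show "AE x in lborel. (\<lambda>m. test_fn a \<tau> (real m) K (0, x) *\<^sub>R f x) \<longlonglongrightarrow> (b * (b * G x)) *\<^sub>R f x"
    proof (rule AE_I2)
      fix x :: 'a
      have "isCont (bump 0) 1" by (rule DERIV_isCont[OF bump_has_real_derivative])
      moreover have "(\<lambda>m. 1 - (norm x)\<^sup>2 / (real m)\<^sup>2) \<longlonglongrightarrow> 1"
        by real_asymp
      ultimately have "(\<lambda>m. bump 0 (1 - (norm x)\<^sup>2 / (real m)\<^sup>2)) \<longlonglongrightarrow> b"
        unfolding b_def by (rule isCont_tendsto_compose)
      then show "(\<lambda>m. test_fn a \<tau> (real m) K (0, x) *\<^sub>R f x) \<longlonglongrightarrow> (b * (b * G x)) *\<^sub>R f x"
        unfolding test_fn_at_0 G_def[symmetric] b_def[symmetric] by (intro tendsto_intros)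
    qed
    show "AE x in lborel. norm (test_fn a \<tau> (real m) K (0, x) *\<^sub>R f x) \<le> 2 * norm (f x * complex_of_real (exp (- (norm x)\<^sup>2 / K\<^sup>2)))" for m
    proof (rule AE_I2)
      fix x :: 'a
      have "b * (bump 0 (1 - (norm x)\<^sup>2 / (real m)\<^sup>2) * (exp (- (norm x)\<^sup>2 / K\<^sup>2) * (1 + cos (a \<bullet> x))))
        \<le> 1 * (1 * (exp (- (norm x)\<^sup>2 / K\<^sup>2) * 2))"
        using b one_plus_cos_bounds[of "a \<bullet> x"] by (intro mult_mono) (auto simp: bump_nonneg bump_0_le_1)
      then have "test_fn a \<tau> (real m) K (0, x) * norm (f x) \<le> 1 * (1 * (exp (- (norm x)\<^sup>2 / K\<^sup>2) * 2)) * norm (f x)"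
        unfolding test_fn_at_0 b_def by (rule mult_right_mono) simp
      moreover have "norm (test_fn a \<tau> (real m) K (0, x) *\<^sub>R f x) = test_fn a \<tau> (real m) K (0, x) * norm (f x)"
        by (simp add: test_fn_nonneg)
      ultimately show "norm (test_fn a \<tau> (real m) K (0, x) *\<^sub>R f x) \<le> 2 * norm (f x * complex_of_real (exp (- (norm x)\<^sup>2 / K\<^sup>2)))"
        by (simp only: norm_mult norm_of_real abs_exp_cancel mult_ac)
    qed
  qed
  have "(LINT x|lborel. (b * (b * G x)) *\<^sub>R f x) = complex_of_real (b\<^sup>2) * (LINT x|lborel. f x * complex_of_real (G x))"
    by (subst integral_mult_right_zero[symmetric])
       (auto simp: scaleR_conv_of_real power2_eq_square mult_ac intro!: Bochner_Integration.integral_cong)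
  then show ?thesis
    using tendsto_Re[OF lim] unfolding G_def[symmetric] b_def[symmetric] by (simp only: Re_complex_of_real_mult)
qed

text \<open>1 + cos combines the characters of frequencies 0, a and -a with weights 1, 1/2 and 1/2.
  The pairings at 0 and -a have non-negative real part and are dropped.\<close>

lemma gaussian_cos_pairing:
  fixes f w :: "'a::euclidean_space \<Rightarrow> complex"
  assumes f: "f has_fourier_transform w" and K: "0 < K" and pos: "AE \<xi> in lborel. 0 \<le> Re (w \<xi>)"
  shows "Re (LINT x|lborel. f x * (complex_of_real (exp (- (norm x)\<^sup>2 / K\<^sup>2)) * cis (- (x \<bullet> a)))) / 2
    \<le> Re (LINT x|lborel. f x * (complex_of_real (exp (- (norm x)\<^sup>2 / K\<^sup>2) * (1 + cos (a \<bullet> x)))))"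
proof -
  let ?P = "\<lambda>v x. f x * (complex_of_real (exp (- (norm x)\<^sup>2 / K\<^sup>2)) * cis (- (x \<bullet> v)))"
  have int: "integrable lborel (?P v)" for v by (rule gaussian_modulated_pairing(2)[OF f K])
  have cos: "complex_of_real (1 + cos y) = 1 + (1 / 2 * cis (- y) + 1 / 2 * cis y)" for y
    by (simp add: complex_eq_iff)
  have "f x * (complex_of_real (exp (- (norm x)\<^sup>2 / K\<^sup>2) * (1 + cos (a \<bullet> x)))) =
      ?P 0 x + (1 / 2 * ?P a x + 1 / 2 * ?P (- a) x)" for x
    unfolding of_real_mult cos by (simp add: inner_commute algebra_simps)
  then have "(LINT x|lborel. f x * (complex_of_real (exp (- (norm x)\<^sup>2 / K\<^sup>2) * (1 + cos (a \<bullet> x))))) =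
      (LINT x|lborel. ?P 0 x) + (1 / 2 * (LINT x|lborel. ?P a x) + 1 / 2 * (LINT x|lborel. ?P (- a) x))"
    using int by (simp only: Bochner_Integration.integral_add integrable_mult_right integral_mult_right_zero Bochner_Integration.integrable_add)
  then show ?thesis
    using gaussian_modulated_pairing_nonneg[OF f K pos, of 0] gaussian_modulated_pairing_nonneg[OF f K pos, of "- a"]
    by simp
qed

section \<open>The two tests combined at the parabolic scale\<close>

lemma time_cutoff_le_1: "time_cutoff \<tau> t \<le> 1"
  by (simp add: time_cutoff_def bump_0_le_1)

text \<open>The choice K = sqrt \<tau> makes 1/\<tau> and 1/K^2 equal, which gives the gain 1/\<tau>
  when a = 0. The oscillating function has no such gain, but it lives on t \<le> 1, where the time
  factor of the weight of duration \<tau> is bounded below and can replace its own cutoff.\<close>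

lemma damped_wave_test_fn_weight_bounds:
  fixes a :: "'a::euclidean_space"
  assumes \<theta>: "0 < \<theta>" "\<theta> < 1"
  obtains B where "0 < B"
    and "\<And>\<tau> N z. 2 \<le> \<tau> \<Longrightarrow> sqrt \<tau> \<le> N \<Longrightarrow> 0 \<le> fst z \<Longrightarrow> \<bar>damped_wave (test_fn (0::'a) \<tau> N (sqrt \<tau>)) z\<bar> \<le>
      B / \<tau> * indicator {0..\<tau>} (fst z) * (test_fn 0 \<tau> N (sqrt \<tau>) z powr \<theta>
        * exp (- ((1 - \<theta>) / 2 / \<tau>) * (norm (snd z))\<^sup>2))"
    and "\<And>\<tau> N z. 2 \<le> \<tau> \<Longrightarrow> sqrt \<tau> \<le> N \<Longrightarrow> 0 \<le> fst z \<Longrightarrow> \<bar>damped_wave (test_fn a 1 N (sqrt \<tau>)) z\<bar> \<le>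
      B * indicator {0..1} (fst z) * (test_fn 0 \<tau> N (sqrt \<tau>) z powr \<theta>
        * exp (- ((1 - \<theta>) / 2 / \<tau>) * (norm (snd z))\<^sup>2))"
proof -
  obtain B0 where B0: "0 < B0" and bd: "\<And>(a::'a) \<tau> N K z. 1 \<le> \<tau> \<Longrightarrow> 1 \<le> K \<Longrightarrow> K \<le> N \<Longrightarrow>
    \<bar>damped_wave (test_fn a \<tau> N K) z\<bar> \<le> B0 * (1 / \<tau> + 1 / K\<^sup>2 + norm a / K + (norm a)\<^sup>2) *
      (time_cutoff \<tau> (fst z) powr \<theta> * (profile N K (snd z \<bullet> snd z) powr \<theta>
        * exp (- ((1 - \<theta>) / 2) * (norm (snd z))\<^sup>2 / K\<^sup>2)))"
    using damped_wave_test_fn_bound[OF \<theta>, where 'a = 'a] by metis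
  \<comment> \<open>Reciprocal of a lower bound for the time factor of the weight on [0, 1], where 1
    - t^2/\<tau>^2 \<ge> 3/4 because \<tau> \<ge> 2.\<close>
  define k where "k = exp (4 / 3 :: real)"
  have k1: "1 \<le> k" by (simp add: k_def)
  \<comment> \<open>An upper bound for the bracket in \<open>bd\<close> with duration 1 and K = sqrt
    \<tau> \<ge> 1.\<close>
  define c where "c = 2 + norm a + (norm a)\<^sup>2"
  have c: "2 \<le> c" by (simp add: c_def)
  define B where "B = B0 * c * k"
  have B: "0 < B" "2 * B0 \<le> B" "B0 * c \<le> B"
    using B0 c k1 mult_mono[of 2 c 1 k] by (simp_all add: B_def mult.assoc)
  have W: "test_fn (0::'a) \<tau> N K z = time_cutoff \<tau> (fst z) * (profile N K (snd z \<bullet> snd z) * 2)" for \<tau> N K z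
    by (simp add: test_fn_def sep_def)
  have zero: "time_cutoff \<tau> t = 0" if "0 < \<tau>" "\<tau> < t" for \<tau> t
    using that by (simp add: time_cutoff_def bump_nonpos power_mono)
  show ?thesis
  proof (rule that[OF B(1)])
    fix \<tau> N :: real and z :: "real \<times> 'a"
    assume \<tau>: "2 \<le> \<tau>" and N: "sqrt \<tau> \<le> N" and z: "0 \<le> fst z"
    define E P where "E = time_cutoff \<tau> (fst z)" and "P = profile N (sqrt \<tau>) (snd z \<bullet> snd z)"
    define e where "e = exp (- ((1 - \<theta>) / 2 / \<tau>) * (norm (snd z))\<^sup>2)"
    have nonneg: "0 \<le> E" "0 \<le> P" "0 \<le> e" by (simp_all add: E_def P_def e_def time_cutoff_nonneg profile_nonneg)
    have K: "1 \<le> sqrt \<tau>" "(sqrt \<tau>)\<^sup>2 = \<tau>" using \<tau> by auto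
    have e: "exp (- ((1 - \<theta>) / 2) * (norm (snd z))\<^sup>2 / (sqrt \<tau>)\<^sup>2) = e" using K by (simp add: e_def)
    show "\<bar>damped_wave (test_fn (0::'a) \<tau> N (sqrt \<tau>)) z\<bar> \<le>
      B / \<tau> * indicator {0..\<tau>} (fst z) * (test_fn 0 \<tau> N (sqrt \<tau>) z powr \<theta> * exp (- ((1 - \<theta>) / 2 / \<tau>) * (norm (snd z))\<^sup>2))"
    proof -
      have "\<bar>damped_wave (test_fn (0::'a) \<tau> N (sqrt \<tau>)) z\<bar> \<le> 2 * B0 / \<tau> * (E powr \<theta> * (P powr \<theta> * e))"
        using bd[of \<tau> "sqrt \<tau>" N 0 z] \<tau> N K unfolding e E_def[symmetric] P_def[symmetric]
        by (simp add: mult.commute)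
      also have "\<dots> \<le> B / \<tau> * indicator {0..\<tau>} (fst z) * ((E * (P * 2)) powr \<theta> * e)"
      proof (cases "fst z \<le> \<tau>")
        case True
        have "E powr \<theta> * P powr \<theta> \<le> (E * (P * 2)) powr \<theta>"
          unfolding powr_mult[symmetric] using nonneg \<theta> by (intro powr_mono2 mult_left_mono mult_nonneg_nonneg) auto
        then have "E powr \<theta> * P powr \<theta> * e \<le> (E * (P * 2)) powr \<theta> * e" using nonneg(3) by (rule mult_right_mono)
        note le1 = this
        have le2: "2 * B0 / \<tau> \<le> B / \<tau>" using B \<tau> by (intro divide_right_mono) auto
        have "2 * B0 / \<tau> * (E powr \<theta> * P powr \<theta> * e) \<le> B / \<tau> * ((E * (P * 2)) powr \<theta> * e)"
          by (rule mult_mono'[OF le2 le1]) (use nonneg B0 \<tau> in auto)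
        then show ?thesis using True z by (simp add: mult.assoc)
      next
        case False
        then show ?thesis using zero[of \<tau> "fst z"] \<tau> by (simp add: E_def)
      qed
      finally show ?thesis unfolding W E_def P_def e_def .
    qed
    show "\<bar>damped_wave (test_fn a 1 N (sqrt \<tau>)) z\<bar> \<le>
      B * indicator {0..1} (fst z) * (test_fn 0 \<tau> N (sqrt \<tau>) z powr \<theta> * exp (- ((1 - \<theta>) / 2 / \<tau>) * (norm (snd z))\<^sup>2))"
    proof -
      define E' where "E' = time_cutoff 1 (fst z)"
      have E': "0 \<le> E'" "E' \<le> 1" by (simp_all add: E'_def time_cutoff_nonneg time_cutoff_le_1)
      have "1 / 1 + 1 / (sqrt \<tau>)\<^sup>2 + norm a / sqrt \<tau> + (norm a)\<^sup>2 \<le> c"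
      proof -
        have "1 / (sqrt \<tau>)\<^sup>2 \<le> 1" using \<tau> K by simp
        moreover have "norm a / sqrt \<tau> \<le> norm a / 1" by (rule divide_left_mono) (use K in auto)
        ultimately show ?thesis by (simp add: c_def)
      qed
      then have "B0 * (1 / 1 + 1 / (sqrt \<tau>)\<^sup>2 + norm a / sqrt \<tau> + (norm a)\<^sup>2) * (E' powr \<theta> * (P powr \<theta> * e))
          \<le> B0 * c * (E' powr \<theta> * (P powr \<theta> * e))"
        using B0 nonneg by (intro mult_right_mono mult_left_mono) auto
      then have "\<bar>damped_wave (test_fn a 1 N (sqrt \<tau>)) z\<bar> \<le> B0 * c * (E' powr \<theta> * (P powr \<theta> * e))"
        using bd[of 1 "sqrt \<tau>" N a z] N K unfolding e E'_def[symmetric] P_def[symmetric] by linarith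
      also have "\<dots> \<le> B * indicator {0..1} (fst z) * ((E * (P * 2)) powr \<theta> * e)"
      proof (cases "fst z \<le> 1")
        case True
        have "(fst z)\<^sup>2 \<le> 1\<^sup>2" "2\<^sup>2 \<le> \<tau>\<^sup>2" using True z \<tau> by (intro power_mono; simp)+
        then have y: "3 / 4 \<le> 1 - (fst z)\<^sup>2 / \<tau>\<^sup>2" using \<tau> by (simp add: field_simps)
        then have "0 < 1 - (fst z)\<^sup>2 / \<tau>\<^sup>2" by linarith
        moreover have "inverse (1 - (fst z)\<^sup>2 / \<tau>\<^sup>2) \<le> 4 / 3" using le_imp_inverse_le[OF y] by simp
        ultimately have "exp (- (4 / 3)) \<le> E" by (simp add: E_def time_cutoff_def bump_def)
        then have "1 \<le> k * E" unfolding k_def by (simp add: exp_minus field_simps)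
        then have "1 * P \<le> k * E * P" using nonneg by (intro mult_right_mono) auto
        also have "\<dots> \<le> k * (E * (P * 2))" using nonneg k1 by simp
        finally have "P powr \<theta> \<le> (k * (E * (P * 2))) powr \<theta>" using nonneg \<theta> by (intro powr_mono2) auto
        also have "\<dots> = k powr \<theta> * (E * (P * 2)) powr \<theta>" by (rule powr_mult)
        also have "\<dots> \<le> k * (E * (P * 2)) powr \<theta>"
          using powr_mono[of \<theta> 1 k] \<theta> k1 by (intro mult_right_mono) auto
        finally have P: "P powr \<theta> \<le> k * (E * (P * 2)) powr \<theta>" .
        have "E' powr \<theta> * P powr \<theta> \<le> 1 * (k * (E * (P * 2)) powr \<theta>)"
          using P E' \<theta> by (intro mult_mono powr_le1) auto
        then have "B0 * c * (E' powr \<theta> * P powr \<theta> * e) \<le> B0 * c * (1 * (k * (E * (P * 2)) powr \<theta>) * e)"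
          using B0 c nonneg by (intro mult_left_mono mult_right_mono) auto
        then show ?thesis using True z by (simp add: B_def mult_ac)
      next
        case False
        then show ?thesis using zero[of 1 "fst z"] by (simp add: E'_def)
      qed
      finally show ?thesis unfolding W E_def P_def e_def .
    qed
  qed
qed

text \<open>The first test, with \<mu> = 1/2 and a = a' = 0, absorbs half of the weighted mass of u
  into its left-hand side. In the second, the remainders are of order \<mu> \<tau>^(1 - p' + n/2)
  and \<mu>^(1 - p') \<tau>^(n/2), n being the dimension; \<mu> = \<tau>^(1/p) is the choice that
  balances them.\<close>

lemma linear_data_bound:
  fixes a :: "'a::euclidean_space"
  assumes p: "1 < p" "1 / p + 1 / p' = 1"
  obtains C where "0 < C" and "\<And>T \<tau> \<epsilon> u0 u1 u w. 2 \<le> \<tau> \<Longrightarrow> ereal \<tau> < T \<Longrightarrow> 0 < \<epsilon> \<Longrightarrow>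
    weak_solution p T \<epsilon> u0 u1 u \<Longrightarrow> (\<lambda>x. u0 x + u1 x) has_fourier_transform w \<Longrightarrow>
    AE \<xi> in lborel. 0 \<le> Re (w \<xi>) \<Longrightarrow>
    \<epsilon> * Re (LINT x|lborel. (u0 x + u1 x) * (complex_of_real (exp (- (norm x)\<^sup>2 / (sqrt \<tau>)\<^sup>2) * (1 + cos (a \<bullet> x)))))
      \<le> C * \<tau> powr (DIM('a) / 2 - (p' - 1) / p)"
proof -
  note p' = conjugate_exponent_gt_1[OF p]
  define \<theta> where "\<theta> = 1 / p"
  have \<theta>: "0 < \<theta>" "\<theta> < 1" using p by (auto simp: \<theta>_def)
  obtain B where B: "0 < B" and bd0: "\<And>\<tau> N z. 2 \<le> \<tau> \<Longrightarrow> sqrt \<tau> \<le> N \<Longrightarrow> 0 \<le> fst z \<Longrightarrow>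
      \<bar>damped_wave (test_fn (0::'a) \<tau> N (sqrt \<tau>)) z\<bar> \<le>
      B / \<tau> * indicator {0..\<tau>} (fst z) * (test_fn 0 \<tau> N (sqrt \<tau>) z powr \<theta>
        * exp (- ((1 - \<theta>) / 2 / \<tau>) * (norm (snd z))\<^sup>2))"
    and bd1: "\<And>\<tau> N z. 2 \<le> \<tau> \<Longrightarrow> sqrt \<tau> \<le> N \<Longrightarrow> 0 \<le> fst z \<Longrightarrow> \<bar>damped_wave (test_fn a 1 N (sqrt \<tau>)) z\<bar> \<le>
      B * indicator {0..1} (fst z) * (test_fn 0 \<tau> N (sqrt \<tau>) z powr \<theta>
        * exp (- ((1 - \<theta>) / 2 / \<tau>) * (norm (snd z))\<^sup>2))"
    using damped_wave_test_fn_weight_bounds[OF \<theta>, of a] by metis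
  define n where "n = real DIM('a)"
  define V where "V = (pi / (p' * ((1 - \<theta>) / 2))) powr (n / 2)"
  define b where "b = bump 0 1"
  have b: "0 < b\<^sup>2" by (simp add: b_def bump_def)
  \<comment> \<open>Dividing by \<open>b\<^sup>2\<close> undoes the constant of
    \<open>test_fn_pairing_tendsto\<close>; the first summand belongs to the absorbed test with
    \<mu> = 1/2, the second to the oscillating one.\<close>
  define C where "C = (2 * (1 / 2) powr (1 - p') * B powr p' * V + B powr p' * V) / b\<^sup>2"
  have V: "0 < V" using p' \<theta> by (simp add: V_def)
  have "0 < C"
    unfolding C_def using B V b by (intro divide_pos_pos add_pos_pos mult_pos_pos) auto
  moreover have "\<epsilon> * Re (LINT x|lborel. (u0 x + u1 x) * (complex_of_real (exp (- (norm x)\<^sup>2 / (sqrt \<tau>)\<^sup>2) * (1 + cos (a \<bullet> x)))))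
      \<le> C * \<tau> powr (DIM('a) / 2 - (p' - 1) / p)"
    if \<tau>: "2 \<le> \<tau>" "ereal \<tau> < T" and \<epsilon>: "0 < \<epsilon>" and sol: "weak_solution p T \<epsilon> u0 u1 u"
      and w: "(\<lambda>x. u0 x + u1 x) has_fourier_transform w" "AE \<xi> in lborel. 0 \<le> Re (w \<xi>)"
    for T \<tau> \<epsilon> u0 u1 u w
  proof -
    define \<kappa> where "\<kappa> = (1 - \<theta>) / 2 / \<tau>"
    have \<kappa>: "0 < \<kappa>" using \<theta> \<tau> by (simp add: \<kappa>_def)
    define J where "J v = Re (LINT x|lborel. (u0 x + u1 x) *
      (complex_of_real (exp (- (norm x)\<^sup>2 / (sqrt \<tau>)\<^sup>2) * (1 + cos (v \<bullet> x)))))" for v :: 'a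
    define j where "j v \<tau>' m = Re (LINT x|lborel. test_fn v \<tau>' (real m) (sqrt \<tau>) (0, x) *\<^sub>R (u0 x + u1 x))" for v :: 'a and \<tau>' m
    define R0 where "R0 = (1 / 2) powr (1 - p') * (B / \<tau>) powr p' * (\<tau> * (pi / (p' * \<kappa>)) powr (n / 2))"
    define \<mu> where "\<mu> = \<tau> powr (1 / p)"
    have \<mu>: "0 < \<mu>" using \<tau> by (simp add: \<mu>_def)
    define R1 where "R1 = \<mu> powr (1 - p') * B powr p' * (1 * (pi / (p' * \<kappa>)) powr (n / 2))"
    have sq: "0 < sqrt \<tau>" using \<tau> by simp
    have fL: "(\<lambda>x. u0 x + u1 x) \<in> L2_space" using w(1) by (simp add: has_fourier_transform_def)
    have lim: "j v \<tau>' \<longlonglongrightarrow> b\<^sup>2 * J v" for v \<tau>'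
      using test_fn_pairing_tendsto[OF fL sq] by (simp add: j_def[abs_def] J_def b_def)
    have J0: "0 \<le> J 0"
      using gaussian_cos_pairing[OF w(1) sq w(2), of 0] gaussian_modulated_pairing_nonneg[OF w(1) sq w(2), of 0]
      by (simp add: J_def)
    have T1: "ereal 1 < T" using \<tau> by (intro le_less_trans[OF _ \<tau>(2)]) auto
    \<comment> \<open>Both tests use the same radius N = m, so the same weighted integral
      \<open>A\<close> occurs in both and can be eliminated.\<close>
    have "\<epsilon> * j a 1 m \<le> \<mu> * (2 * R0 - 2 * \<epsilon> * j 0 \<tau> m) + R1" if m: "sqrt \<tau> \<le> real m" for m
    proof -
      define A where "A = (LINT z:strip T|lborel. norm (u z) powr p * test_fn (0::'a) \<tau> (real m) (sqrt \<tau>) z)"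
      define A' where "A' = (LINT z:strip T|lborel. norm (u z) powr p * test_fn a 1 (real m) (sqrt \<tau>) z)"
      have m0: "0 < real m" using sq m by linarith
      have "A + \<epsilon> * j 0 \<tau> m \<le> 1 / 2 * A + R0"
        unfolding A_def j_def R0_def n_def
        by (rule weak_solution_test_estimate[OF sol p])
           (use bd0[OF \<tau>(1) m] \<tau> m0 \<kappa> B in \<open>auto simp: \<theta>_def \<kappa>_def\<close>)
      then have A: "A \<le> 2 * R0 - 2 * \<epsilon> * j 0 \<tau> m" by simp
      have "A' + \<epsilon> * j a 1 m \<le> \<mu> * A + R1"
        unfolding A_def A'_def j_def R1_def n_def
        by (rule weak_solution_test_estimate[OF sol p])
           (use bd1[OF \<tau>(1) m] \<tau> T1 m0 \<kappa> B \<mu> in \<open>auto simp: \<theta>_def \<kappa>_def\<close>)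
      moreover have "0 \<le> A'"
        unfolding A'_def set_lebesgue_integral_def
        by (intro integral_nonneg_AE AE_I2 scaleR_nonneg_nonneg mult_nonneg_nonneg test_fn_nonneg) auto
      moreover have "\<mu> * A \<le> \<mu> * (2 * R0 - 2 * \<epsilon> * j 0 \<tau> m)" using A \<mu> by simp
      ultimately show ?thesis by linarith
    qed
    then have ev: "\<forall>\<^sub>F m in sequentially. \<epsilon> * j a 1 m \<le> \<mu> * (2 * R0 - 2 * \<epsilon> * j 0 \<tau> m) + R1"
      using eventually_ge_at_top[of "nat \<lceil>sqrt \<tau>\<rceil>"] by (auto elim!: eventually_mono simp: nat_le_iff ceiling_le_iff)
    \<comment> \<open>Fourier positivity is available only for the full Gaussian: after the limit
      the term with \<open>J 0\<close> has a sign and is discarded.\<close>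
    have "\<epsilon> * (b\<^sup>2 * J a) \<le> \<mu> * (2 * R0 - 2 * \<epsilon> * (b\<^sup>2 * J 0)) + R1"
      by (rule tendsto_le[OF sequentially_bot _ tendsto_mult_left[OF lim] ev],
          rule tendsto_add[OF tendsto_mult_left[OF tendsto_diff[OF tendsto_const tendsto_mult_left[OF lim]]] tendsto_const])
    also have "\<dots> \<le> 2 * \<mu> * R0 + R1"
      using mult_nonneg_nonneg[OF mult_nonneg_nonneg[OF less_imp_le[OF \<mu>] less_imp_le[OF \<epsilon>]]
          mult_nonneg_nonneg[OF less_imp_le[OF b] J0]] by (simp add: algebra_simps)
    also have "\<dots> = b\<^sup>2 * (C * \<tau> powr (n / 2 - (p' - 1) / p))"
    proof -
      have "(pi / (p' * \<kappa>)) powr (n / 2) = (pi / (p' * ((1 - \<theta>) / 2)) * \<tau>) powr (n / 2)"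
        by (simp add: \<kappa>_def mult.assoc)
      also have "\<dots> = V * \<tau> powr (n / 2)"
        unfolding V_def by (rule powr_mult)
      finally have vol: "(pi / (p' * \<kappa>)) powr (n / 2) = V * \<tau> powr (n / 2)" .
      \<comment> \<open>By p'/p = p' - 1, the sum 1/p + 1 - p' equals -(p' - 1)/p.\<close>
      have ex: "1 / p + - p' + 1 + n / 2 = n / 2 - (p' - 1) / p"
        using p'(2) by (simp add: diff_divide_distrib)
      have "\<mu> * ((B / \<tau>) powr p' * (\<tau> * \<tau> powr (n / 2))) = B powr p' * \<tau> powr (n / 2 - (p' - 1) / p)"
      proof -
        have "\<mu> * ((B / \<tau>) powr p' * (\<tau> * \<tau> powr (n / 2)))
            = B powr p' * (\<tau> powr (1 / p) * \<tau> powr (- p') * \<tau> powr 1 * \<tau> powr (n / 2))"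
        proof -
          have "(B / \<tau>) powr p' = B powr p' * \<tau> powr (- p')"
            unfolding powr_divide powr_minus by (rule divide_inverse)
          moreover have "\<tau> powr 1 = \<tau>" using \<tau> by simp
          ultimately show ?thesis unfolding \<mu>_def by (simp only: mult_ac)
        qed
        also have "\<tau> powr (1 / p) * \<tau> powr (- p') * \<tau> powr 1 * \<tau> powr (n / 2) = \<tau> powr (n / 2 - (p' - 1) / p)"
          unfolding powr_add[symmetric] ex ..
        finally show ?thesis .
      qed
      moreover have "\<mu> powr (1 - p') * \<tau> powr (n / 2) = \<tau> powr (n / 2 - (p' - 1) / p)"
      proof -
        have "1 / p * (1 - p') + n / 2 = n / 2 - (p' - 1) / p" by (simp add: diff_divide_distrib)
        then show ?thesis unfolding \<mu>_def powr_powr powr_add[symmetric] by (rule arg_cong)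
      qed
      moreover have "2 * \<mu> * R0 + R1 = 2 * (1 / 2) powr (1 - p') * V * (\<mu> * ((B / \<tau>) powr p' * (\<tau> * \<tau> powr (n / 2))))
        + B powr p' * V * (\<mu> powr (1 - p') * \<tau> powr (n / 2))"
        unfolding R0_def R1_def vol by (simp only: mult_ac mult_1)
      ultimately have "2 * \<mu> * R0 + R1 = (2 * (1 / 2) powr (1 - p') * B powr p' * V + B powr p' * V) * \<tau> powr (n / 2 - (p' - 1) / p)"
        by (simp only: distrib_left distrib_right mult_ac)
      then show ?thesis unfolding C_def using b by simp
    qed
    finally have "b\<^sup>2 * (\<epsilon> * J a) \<le> b\<^sup>2 * (C * \<tau> powr (n / 2 - (p' - 1) / p))" by (simp only: mult_ac)
    then show ?thesis using b by (simp add: J_def n_def)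
  qed
  ultimately show ?thesis using that by blast
qed

section \<open>The lifespan estimate\<close>

text \<open>The lower bound at K = sqrt \<tau> and \<open>linear_data_bound\<close> are compared at
  every large \<tau> < T. The logarithm is traded for \<tau>^(\<delta>/p), and what remains is
  \<tau>^D \<le> M/\<epsilon> with 1/D the claimed exponent.\<close>

lemma lifespan_bound:
  fixes u0 u1 w :: "'a::euclidean_space \<Rightarrow> complex" and a :: 'a
  assumes p: "1 < p" "1 / p + 1 / p' = 1"
    and w: "(\<lambda>x. u0 x + u1 x) has_fourier_transform w" "AE \<xi> in lborel. 0 \<le> Re (w \<xi>)"
    and "0 < r" "0 < c"
    and low: "AE \<xi> in lborel. \<xi> \<in> ball 0 r \<longrightarrow>
      c * norm \<xi> powr (- real DIM('a) / 2) * inverse (ln (inverse (norm \<xi>))) \<le> Re (w (\<xi> + a))"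
    and \<delta>: "0 < \<delta>" "\<delta> < p' - 1 - DIM('a) / 4 * p"
  obtains C where "0 < C" and "\<And>\<epsilon> T u. 0 < \<epsilon> \<Longrightarrow> \<epsilon> < 1 \<Longrightarrow> weak_solution p T \<epsilon> u0 u1 u \<Longrightarrow>
    T \<le> ereal (C * \<epsilon> powr (- (p / (p' - 1 - DIM('a) / 4 * p - \<delta>))))"
proof -
  define n where "n = real DIM('a)"
  define D where "D = (p' - 1 - n / 4 * p - \<delta>) / p"
  have D: "0 < D" using \<delta> p by (simp add: D_def n_def)
  obtain C1 where C1: "0 < C1" "\<And>T \<tau> \<epsilon> u0 u1 u w. 2 \<le> \<tau> \<Longrightarrow> ereal \<tau> < T \<Longrightarrow> 0 < \<epsilon> \<Longrightarrow>
    weak_solution p T \<epsilon> u0 u1 u \<Longrightarrow> (\<lambda>x. u0 x + u1 x) has_fourier_transform w \<Longrightarrow>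
    AE \<xi> in lborel. 0 \<le> Re (w \<xi>) \<Longrightarrow>
    \<epsilon> * Re (LINT x|lborel. (u0 x + u1 x) * (complex_of_real (exp (- (norm x)\<^sup>2 / (sqrt \<tau>)\<^sup>2) * (1 + cos (a \<bullet> x)))))
      \<le> C1 * \<tau> powr (n / 2 - (p' - 1) / p)"
    unfolding n_def by (rule linear_data_bound[OF p, of a]) blast
  obtain c1 where c1: "0 < c1" "\<And>K. 1 < K \<Longrightarrow> 1 / K < r \<Longrightarrow> c1 * K powr (n / 2) / ln (2 * K) \<le>
      Re (LINT x|lborel. (u0 x + u1 x) * (complex_of_real (exp (- (norm x)\<^sup>2 / K\<^sup>2)) * cis (- (x \<bullet> a))))"
    unfolding n_def by (rule gaussian_modulated_pairing_lower_bound[OF w \<open>0 < c\<close> low]) blast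
  \<comment> \<open>Chosen so that (2 sqrt \<tau>)^\<alpha> equals 2^\<alpha> \<tau>^(\<delta>/p),
    the loss already accounted for in \<open>D\<close>.\<close>
  define \<alpha> where "\<alpha> = 2 * \<delta> / p"
  have \<alpha>: "0 < \<alpha>" using \<delta> p by (simp add: \<alpha>_def)
  \<comment> \<open>For \<tau> \<ge> \<tau>0 both \<tau> \<ge> 2, as
    \<open>linear_data_bound\<close> requires, and sqrt \<tau> > 1/r, which places the annulus
    inside the ball of radius r.\<close>
  define \<tau>0 where "\<tau>0 = 2 + (1 / r)\<^sup>2"
  have \<tau>0: "2 \<le> \<tau>0" by (simp add: \<tau>0_def)
  define M where "M = 2 * C1 * (2 powr \<alpha> / \<alpha>) / c1"
  have M: "0 < M" using C1 c1 \<alpha> by (simp add: M_def)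
  have key: "\<tau> \<le> M powr (1 / D) * \<epsilon> powr (- (1 / D))"
    if \<tau>: "\<tau>0 \<le> \<tau>" "ereal \<tau> < T" and \<epsilon>: "0 < \<epsilon>" and sol: "weak_solution p T \<epsilon> u0 u1 u" for \<tau> T \<epsilon> u
  proof -
    have \<tau>2: "2 \<le> \<tau>" "0 < \<tau>" using \<tau> \<tau>0 by auto
    have K: "1 < sqrt \<tau>" "0 < sqrt \<tau>" using \<tau>2 by auto
    have "1 / r < sqrt \<tau>"
      by (rule real_less_rsqrt) (use \<tau> in \<open>simp add: \<tau>0_def\<close>)
    then have Kr: "1 / sqrt \<tau> < r" using \<open>0 < r\<close> K by (simp add: field_simps)
    let ?P = "Re (LINT x|lborel. (u0 x + u1 x) * (complex_of_real (exp (- (norm x)\<^sup>2 / (sqrt \<tau>)\<^sup>2)) * cis (- (x \<bullet> a))))"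
    have l: "0 < ln (2 * sqrt \<tau>)" using K by (intro ln_gt_zero) linarith
    have sq: "sqrt \<tau> powr y = \<tau> powr (y / 2)" for y
      using \<tau>2 by (simp add: powr_half_sqrt[symmetric] powr_powr)
    have "\<epsilon> * (c1 * \<tau> powr (n / 4) / ln (2 * sqrt \<tau>)) \<le> \<epsilon> * ?P"
      using mult_left_mono[OF c1(2)[OF K(1) Kr], of \<epsilon>] \<epsilon> unfolding sq by simp
    also have "\<dots> \<le> \<epsilon> * (2 * Re (LINT x|lborel. (u0 x + u1 x) *
        (complex_of_real (exp (- (norm x)\<^sup>2 / (sqrt \<tau>)\<^sup>2) * (1 + cos (a \<bullet> x))))))"
      using gaussian_cos_pairing[OF w(1) K(2) w(2), of a] \<epsilon> by (intro mult_left_mono) auto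
    also have "\<dots> \<le> 2 * (C1 * \<tau> powr (n / 2 - (p' - 1) / p))"
      using C1(2)[OF \<tau>2(1) \<tau>(2) \<epsilon> sol w] by simp
    finally have "\<epsilon> * c1 * \<tau> powr (n / 4) \<le> 2 * C1 * \<tau> powr (n / 2 - (p' - 1) / p) * ln (2 * sqrt \<tau>)"
      using l by (simp add: field_simps)
    also have "\<dots> \<le> 2 * C1 * \<tau> powr (n / 2 - (p' - 1) / p) * (2 powr \<alpha> / \<alpha> * \<tau> powr (\<delta> / p))"
    proof (rule mult_left_mono)
      have "ln (2 * sqrt \<tau>) \<le> (2 * sqrt \<tau>) powr \<alpha> / \<alpha>" using K(1) \<alpha> by (intro ln_powr_bound) linarith+
      also have "(2 * sqrt \<tau>) powr \<alpha> = 2 powr \<alpha> * \<tau> powr (\<delta> / p)"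
        using K by (simp add: powr_mult sq \<alpha>_def)
      finally show "ln (2 * sqrt \<tau>) \<le> 2 powr \<alpha> / \<alpha> * \<tau> powr (\<delta> / p)" by simp
    qed (use C1 in auto)
    also have "\<dots> = c1 * M * \<tau> powr (n / 2 - (p' - 1) / p + \<delta> / p)"
      using c1 by (simp add: M_def powr_add)
    also have "n / 2 - (p' - 1) / p + \<delta> / p = n / 4 - D"
      using p by (simp add: D_def field_simps)
    finally have "\<epsilon> * c1 * \<tau> powr (n / 4) \<le> c1 * M * (\<tau> powr (n / 4) / \<tau> powr D)"
      by (simp add: powr_diff)
    then have "\<tau> powr D \<le> M / \<epsilon>" using c1 \<tau>2 \<epsilon> by (simp add: field_simps)
    then have "(\<tau> powr D) powr (1 / D) \<le> (M / \<epsilon>) powr (1 / D)" using D by (intro powr_mono2) auto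
    moreover have "(\<tau> powr D) powr (1 / D) = \<tau>" using D \<tau>2 by (simp add: powr_powr)
    ultimately show ?thesis using \<epsilon> by (simp add: powr_mult powr_minus divide_inverse inverse_powr)
  qed
  \<comment> \<open>The summand \<open>\<tau>0\<close> covers times too short for
    \<open>key\<close>: since \<epsilon> < 1, the power of \<epsilon> is at least 1, and the bound
    is at least \<tau>0.\<close>
  define C where "C = \<tau>0 + M powr (1 / D)"
  have "0 < C" using \<tau>0 by (simp add: C_def add_pos_nonneg)
  moreover have "T \<le> ereal (C * \<epsilon> powr (- (1 / D)))"
    if \<epsilon>: "0 < \<epsilon>" "\<epsilon> < 1" and sol: "weak_solution p T \<epsilon> u0 u1 u" for \<epsilon> T u
  proof (rule ccontr)
    assume "\<not> ?thesis"
    \<comment> \<open>A time strictly between the claimed bound and T exceeds \<tau>0, so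
      \<open>key\<close> applies to it and contradicts its choice.\<close>
    then obtain \<tau> where \<tau>: "ereal (C * \<epsilon> powr (- (1 / D))) < ereal \<tau>" "ereal \<tau> < T"
      using ereal_dense2[of "ereal (C * \<epsilon> powr (- (1 / D)))" T] by (auto simp: not_le)
    have "1 \<le> \<epsilon> powr (- (1 / D))"
      using \<epsilon> D by (simp add: powr_minus powr_le1 one_le_inverse_iff)
    then have "\<tau>0 * 1 \<le> \<tau>0 * \<epsilon> powr (- (1 / D))" using \<tau>0 by (intro mult_left_mono) auto
    then have "\<tau>0 + M powr (1 / D) * \<epsilon> powr (- (1 / D)) \<le> C * \<epsilon> powr (- (1 / D))"
      by (simp add: C_def distrib_right)
    moreover have "0 \<le> M powr (1 / D) * \<epsilon> powr (- (1 / D))" by simp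
    moreover have "C * \<epsilon> powr (- (1 / D)) < \<tau>" using \<tau>(1) by simp
    moreover have "\<tau> \<le> M powr (1 / D) * \<epsilon> powr (- (1 / D))" if "\<tau>0 \<le> \<tau>"
      by (rule key[OF that \<tau>(2) \<epsilon>(1) sol])
    ultimately show False using \<tau>0 by linarith
  qed
  moreover have "1 / D = p / (p' - 1 - DIM('a) / 4 * p - \<delta>)" by (simp add: D_def n_def)
  ultimately show ?thesis using that by metis
qed

theorem theorem4:
  fixes u0 u1 w :: "real ^ 'n \<Rightarrow> complex"
    and a :: "real ^ 'n"
    and s \<gamma> p p' r c n :: real
  defines "n \<equiv> real CARD('n)"
  assumes "0 < s" "s \<le> 1" "0 < \<gamma>"
    and "1 < p" "1 / p + 1 / p' = 1" "1 + n / 4 * p < p'"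
    and "u0 \<in> sobolev_space s \<inter> homogeneous_sobolev_L2 (- \<gamma>)"
    and "u1 \<in> L2_space \<inter> homogeneous_sobolev_L2 (- \<gamma>)"
    and "(\<lambda>x. u0 x + u1 x) has_fourier_transform w"
    and "AE \<xi> in lborel. Im (w \<xi>) = 0 \<and> 0 \<le> Re (w \<xi>)"
    and "0 < r" "a \<noteq> 0" "0 < c"
    and "AE \<xi> in lborel. \<xi> \<in> ball 0 r \<longrightarrow>
           c * norm \<xi> powr (- n / 2) * inverse (ln (inverse (norm \<xi>))) \<le> Re (w (\<xi> + a))"
  shows "(\<forall>\<^sub>F \<epsilon> in at_right 0. \<not> (\<exists>u. weak_solution p \<infinity> \<epsilon> u0 u1 u)) \<and>
    (\<forall>\<^sub>F \<delta> in at_right 0. \<exists>C>0. \<forall>\<^sub>F \<epsilon> in at_right 0.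
       \<forall>T u. 0 < T \<longrightarrow> weak_solution p T \<epsilon> u0 u1 u \<longrightarrow>
         T \<le> ereal (C * \<epsilon> powr (- (p / (p' - 1 - n / 4 * p - \<delta>)))))"
proof -
  \<comment> \<open>Positive by the condition 1 + n p/4 < p'; it is also the threshold below which
    \<delta> is admissible.\<close>
  define D where "D = p' - 1 - n / 4 * p"
  have D: "0 < D" using assms by (simp add: D_def)
  have w: "AE \<xi> in lborel. 0 \<le> Re (w \<xi>)" using assms(11) by eventually_elim simp
  have small: "\<forall>\<^sub>F \<epsilon> in at_right 0. 0 < \<epsilon> \<and> \<epsilon> < (d::real)" if "0 < d" for d
    using eventually_at_right_less[of 0] eventually_at_right_real[OF that] by eventually_elim auto
  have bound: "\<exists>C>0. \<forall>\<epsilon> T u. 0 < \<epsilon> \<longrightarrow> \<epsilon> < 1 \<longrightarrow> weak_solution p T \<epsilon> u0 u1 u \<longrightarrow>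
      T \<le> ereal (C * \<epsilon> powr (- (p / (p' - 1 - n / 4 * p - \<delta>))))" if "0 < \<delta>" "\<delta> < D" for \<delta>
  proof -
    have dim: "real DIM(real ^ 'n) = n" by (simp add: n_def)
    show ?thesis
      by (rule lifespan_bound[OF assms(5,6,10) w assms(12,14), of a \<delta>, unfolded dim])
         (use assms(15) that in \<open>auto simp: D_def\<close>)
  qed
  have life: "\<forall>\<^sub>F \<delta> in at_right 0. \<exists>C>0. \<forall>\<^sub>F \<epsilon> in at_right 0.
       \<forall>T u. 0 < T \<longrightarrow> weak_solution p T \<epsilon> u0 u1 u \<longrightarrow>
         T \<le> ereal (C * \<epsilon> powr (- (p / (p' - 1 - n / 4 * p - \<delta>))))"
    using small[OF D]
  proof eventually_elim
    case (elim \<delta>)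
    then obtain C where C: "0 < C" "\<And>\<epsilon> T u. 0 < \<epsilon> \<Longrightarrow> \<epsilon> < 1 \<Longrightarrow> weak_solution p T \<epsilon> u0 u1 u \<Longrightarrow>
      T \<le> ereal (C * \<epsilon> powr (- (p / (p' - 1 - n / 4 * p - \<delta>))))"
      using bound[of \<delta>] by auto
    have "\<forall>\<^sub>F \<epsilon> in at_right 0. \<forall>T u. 0 < T \<longrightarrow> weak_solution p T \<epsilon> u0 u1 u \<longrightarrow>
         T \<le> ereal (C * \<epsilon> powr (- (p / (p' - 1 - n / 4 * p - \<delta>))))"
      using small[of 1] by (rule eventually_mono) (use C(2) in auto)
    then show ?case using C(1) by blast
  qed
  moreover have "\<forall>\<^sub>F \<epsilon> in at_right 0. \<not> (\<exists>u. weak_solution p \<infinity> \<epsilon> u0 u1 u)"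
  proof -
    \<comment> \<open>A global solution would make \<infinity> at most a real number; one admissible
      \<delta> is enough for this, here D/2.\<close>
    obtain C where C: "\<And>\<epsilon> T u. 0 < \<epsilon> \<Longrightarrow> \<epsilon> < 1 \<Longrightarrow> weak_solution p T \<epsilon> u0 u1 u \<Longrightarrow>
      T \<le> ereal (C * \<epsilon> powr (- (p / (p' - 1 - n / 4 * p - D / 2))))"
      using bound[of "D / 2"] D by auto
    show ?thesis
      using small[of 1] by (rule eventually_mono) (use C in force)+
  qed
  ultimately show ?thesis by blast
qed

end
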